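(* Let $n,d,n_T,n_V$ be positive integers, $\boldsymbol{D}\in\mathbb{R}^{n\times d}$, $\boldsymbol{Q}^T\in\mathbb{R}^{n_T\times d}$, $\boldsymbol{Q}^V\in\mathbb{R}^{n_V\times d}$, $Y^T\in[n]^{n_T}$ and $Y^V\in[n]^{n_V}$. There exists an algorithm, referred to as NUDGE-M, that optimally solves the problem BiMax-M (defined in the context) in time $O(n_V(nd+\log n_V)+n_Td)$. Specifically, NUDGE-M sets the optimal solution $\boldsymbol{\Delta}^M\in\mathbb{R}^{n\times d}$ of BiMax-M as $$\boldsymbol{\Delta}^M_i=\gamma^*\frac{\boldsymbol{G}_i}{\|\boldsymbol{G}_i\|},\qquad\text{where}\quad \boldsymbol{G}_i=\sum_{j\in[n_T]}\mathbb{I}[i=Y^T_j]\,\boldsymbol{Q}^T_j,\qquad \forall i\in[n],$$ for an optimally chosen scalar $\gamma^*$ (where $\boldsymbol{G}_i/\|\boldsymbol{G}_i\|$ is read as $\boldsymbol{0}$ when $\boldsymbol{G}_i=\boldsymbol{0}$).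
   Context: $[s]=\{1,\dots,s\}$; $\boldsymbol{X}_i$ is the $i$-th row of a matrix $\boldsymbol{X}$; $\|\cdot\|$ is the Euclidean norm; $\mathbb{I}[\cdot]$ is the indicator of a predicate. $\boldsymbol{D}$ contains the embeddings of $n$ data records, $(\boldsymbol{Q}^T,Y^T)$ the embeddings of the training queries and the indices of their ground-truth data records, and $(\boldsymbol{Q}^V,Y^V)$ the embeddings of the validation queries and the indices of their ground-truth data records. For a scalar $\gamma\ge 0$, let $\texttt{MaxS-M}(\gamma)$ be the set of optimal solutions of $$\max_{\boldsymbol{\Delta}\in\mathbb{R}^{n\times d}}\ \sum_{i\in[n_T]}\boldsymbol{Q}^T_i\cdot(\boldsymbol{D}_{Y^T_i}+\boldsymbol{\Delta}_{Y^T_i})\quad\text{s.t. } \|\boldsymbol{\Delta}_i\|\le\gamma\ \ \forall i\in[n].$$ For $i\in[n_V]$, let $\mathcal{I}^V_i(\boldsymbol{\Delta})=1$ if $\boldsymbol{Q}^V_i\cdot(\boldsymbol{D}_{Y^V_i}+\boldsymbol{\Delta}_{Y^V_i})>\boldsymbol{Q}^V_i\cdot(\boldsymbol{D}_j+\boldsymbol{\Delta}_j)$ for all $j\in[n]\setminus\{Y^V_i\}$, and $\mathcal{I}^V_i(\boldsymbol{\Delta})=0$ otherwise. BiMax-M (bi-level maximization with bounded magnitude) is the problem $$\max\ \sum_{i\in[n_V]}\mathcal{I}^V_i(\boldsymbol{\Delta})\quad\text{s.t. } \boldsymbol{\Delta}\in\texttt{MaxS-M}(\gamma),\ \gamma\ge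 0.$$
   Formalization: The claim fails when some G_i = 0, since Δ_i is then free in its ball; optimality for BiMax-M is proved when all G_i ≠ 0, and in general among feasible (γ, Δ) with Δ_i = 0 wherever G_i = 0. *)

theory Defs
  imports Complex_Main "Jordan_Normal_Form.Matrix"
begin

section \<open>The optimization problems\<close>

text \<open>
  A family of $r$ embeddings in $d$-dimensional Euclidean space is a real $r \times d$ matrix, one
  embedding per row; the numbers of records and queries are the row dimensions. Indices start at
  $0$, so the index set $[s]$ is \<open>{..<s}\<close>. Ground-truth indices are functions on \<open>nat\<close>
  of which only the values at query indices matter.
\<close>

definition euclid_norm :: "real vec \<Rightarrow> real" where
  "euclid_norm v = sqrt (v \<bullet> v)"

definition train_score ::
    "real mat \<Rightarrow> real mat \<Rightarrow> (nat \<Rightarrow> nat) \<Rightarrow> real mat \<Rightarrow> real" where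
  "train_score D QT YT \<Delta> =
     (\<Sum>i<dim_row QT. row QT i \<bullet> (row D (YT i) + row \<Delta> (YT i)))"

definition bounded_magnitude :: "real mat \<Rightarrow> real \<Rightarrow> real mat \<Rightarrow> bool" where
  "bounded_magnitude D \<gamma> \<Delta> \<longleftrightarrow>
     \<Delta> \<in> carrier_mat (dim_row D) (dim_col D) \<and>
     (\<forall>i<dim_row D. euclid_norm (row \<Delta> i) \<le> \<gamma>)"

definition MaxS_M ::
    "real mat \<Rightarrow> real mat \<Rightarrow> (nat \<Rightarrow> nat) \<Rightarrow> real \<Rightarrow> real mat set" where
  "MaxS_M D QT YT \<gamma> =
     {\<Delta>. is_arg_max (train_score D QT YT) (bounded_magnitude D \<gamma>) \<Delta>}"

definition val_correct ::
    "real mat \<Rightarrow> real mat \<Rightarrow> (nat \<Rightarrow> nat) \<Rightarrow> real mat \<Rightarrow> nat \<Rightarrow> bool" where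
  "val_correct D QV YV \<Delta> i \<longleftrightarrow>
     (\<forall>j \<in> {..<dim_row D} - {YV i}.
        row QV i \<bullet> (row D (YV i) + row \<Delta> (YV i)) > row QV i \<bullet> (row D j + row \<Delta> j))"

definition val_score ::
    "real mat \<Rightarrow> real mat \<Rightarrow> (nat \<Rightarrow> nat) \<Rightarrow> real mat \<Rightarrow> nat" where
  "val_score D QV YV \<Delta> = (\<Sum>i<dim_row QV. of_bool (val_correct D QV YV \<Delta> i))"

text \<open>The decision variables of the bi-level problem are the pairs $(\gamma, \Delta)$.\<close>

definition BiMax_M_feasible ::
    "real mat \<Rightarrow> real mat \<Rightarrow> (nat \<Rightarrow> nat) \<Rightarrow> real \<times> real mat \<Rightarrow> bool" where
  "BiMax_M_feasible D QT YT = (\<lambda>(\<gamma>, \<Delta>). \<Delta> \<in> MaxS_M D QT YT \<gamma> \<and> \<gamma> \<ge> 0)"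

definition BiMax_M_objective ::
    "real mat \<Rightarrow> real mat \<Rightarrow> (nat \<Rightarrow> nat) \<Rightarrow> real \<times> real mat \<Rightarrow> nat" where
  "BiMax_M_objective D QV YV = (\<lambda>(\<gamma>, \<Delta>). val_score D QV YV \<Delta>)"

definition BiMax_M_optimal ::
    "real mat \<Rightarrow> real mat \<Rightarrow> (nat \<Rightarrow> nat) \<Rightarrow> real mat \<Rightarrow> (nat \<Rightarrow> nat) \<Rightarrow>
     real \<times> real mat \<Rightarrow> bool" where
  "BiMax_M_optimal D QT YT QV YV =
     is_arg_max (BiMax_M_objective D QV YV) (BiMax_M_feasible D QT YT)"

definition train_gradient ::
    "real mat \<Rightarrow> real mat \<Rightarrow> (nat \<Rightarrow> nat) \<Rightarrow> real mat" where
  "train_gradient D QT YT =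
     mat (dim_row D) (dim_col D)
       (\<lambda>(i, k). \<Sum>j<dim_row QT. of_bool (i = YT j) * QT $$ (j, k))"

text \<open>A zero row of the gradient gives a zero row here, because \<open>0 / 0 = 0\<close>.\<close>

definition nudge_M ::
    "real mat \<Rightarrow> real mat \<Rightarrow> (nat \<Rightarrow> nat) \<Rightarrow> real \<Rightarrow> real mat" where
  "nudge_M D QT YT \<gamma> =
     (let G = train_gradient D QT YT
      in mat (dim_row D) (dim_col D)
           (\<lambda>(i, k). \<gamma> * (G $$ (i, k) / euclid_norm (row G i))))"

text \<open>
  If row \<open>i\<close> of the gradient vanishes, the training objective does not depend on row \<open>i\<close> of
  \<open>\<Delta>\<close>, so \<open>MaxS_M\<close> leaves that row free within its ball. The following predicate
  selects the perturbations that leave such records in place.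
\<close>

definition fixes_untrained ::
    "real mat \<Rightarrow> real mat \<Rightarrow> (nat \<Rightarrow> nat) \<Rightarrow> real \<times> real mat \<Rightarrow> bool" where
  "fixes_untrained D QT YT = (\<lambda>(\<gamma>, \<Delta>).
     \<forall>i<dim_row D. row (train_gradient D QT YT) i = 0\<^sub>v (dim_col D) \<longrightarrow>
                   row \<Delta> i = 0\<^sub>v (dim_col D))"

text \<open>
  Vanishing rows can make every matrix of the form \<open>nudge_M D QT YT \<gamma>\<close> suboptimal. Below, record
  1 is no ground truth of a training query, but moving it along the validation query, which is
  orthogonal to the training query, answers the validation query correctly.
\<close>

lemma nudge_M_suboptimal_with_vanishing_row:
  defines "D \<equiv> 0\<^sub>m 2 2 :: real mat"
    and "QT \<equiv> mat 1 2 (\<lambda>(i, k). of_bool (k = 0)) :: real mat"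
    and "QV \<equiv> mat 1 2 (\<lambda>(i, k). of_bool (k = 1)) :: real mat"
    and "YT \<equiv> \<lambda>_::nat. 0::nat"
    and "YV \<equiv> \<lambda>_::nat. 1::nat"
  shows "\<not> BiMax_M_optimal D QT YT QV YV (\<gamma>, nudge_M D QT YT \<gamma>)"
proof -
  have two: "{0..<2} = {0, 1::nat}" "{..<2} = {0, 1::nat}" "\<And>i::nat. i < 2 \<longleftrightarrow> i = 0 \<or> i = 1"
    by auto
  note ev = D_def QT_def QV_def YT_def YV_def scalar_prod_def two
  have ts: "train_score D QT YT \<Delta> = \<Delta> $$ (0, 0)" if "\<Delta> \<in> carrier_mat 2 2" for \<Delta>
    using that by (simp add: train_score_def ev)
  have vs: "val_score D QV YV \<Delta> = of_bool (\<Delta> $$ (1, 1) > \<Delta> $$ (0, 1))"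
    if "\<Delta> \<in> carrier_mat 2 2" for \<Delta>
  proof -
    have "{0, 1} - {1} = {0::nat}" by auto
    then show ?thesis using that by (simp add: val_score_def val_correct_def ev)
  qed
  have low: "val_score D QV YV (nudge_M D QT YT \<gamma>) = 0"
    by (subst vs) (simp_all add: nudge_M_def train_gradient_def Let_def ev)
  define \<Delta> :: "real mat" where "\<Delta> = 1\<^sub>m 2"
  have \<Delta>: "\<Delta> \<in> carrier_mat 2 2" by (simp add: \<Delta>_def)
  have "bounded_magnitude D 1 \<Delta>"
    by (auto simp: bounded_magnitude_def euclid_norm_def \<Delta>_def ev)
  moreover have "\<Delta>' $$ (0, 0) \<le> 1" if "bounded_magnitude D 1 \<Delta>'" for \<Delta>'
  proof -
    have c: "\<Delta>' \<in> carrier_mat 2 2" and "euclid_norm (row \<Delta>' 0) \<le> 1"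
      using that by (auto simp: bounded_magnitude_def D_def)
    then have "sqrt ((\<Delta>' $$ (0, 0))\<^sup>2 + (\<Delta>' $$ (0, 1))\<^sup>2) \<le> 1"
      by (simp add: euclid_norm_def ev power2_eq_square)
    with real_sqrt_sum_squares_ge1[of "\<Delta>' $$ (0, 0)" "\<Delta>' $$ (0, 1)"] show ?thesis
      by linarith
  qed
  moreover have "bounded_magnitude D 1 \<Delta>' \<Longrightarrow> \<Delta>' \<in> carrier_mat 2 2" for \<Delta>'
    by (simp add: bounded_magnitude_def D_def)
  ultimately have "\<Delta> \<in> MaxS_M D QT YT 1"
    by (simp add: MaxS_M_def is_arg_max_def ts \<Delta>) (auto simp: \<Delta>_def ts not_less)
  then have "BiMax_M_feasible D QT YT (1, \<Delta>)"
    by (simp add: BiMax_M_feasible_def)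
  moreover have "val_score D QV YV \<Delta> = 1"
    by (simp add: vs \<Delta>) (simp add: \<Delta>_def)
  ultimately show ?thesis
    using low
    by (auto simp: BiMax_M_optimal_def is_arg_max_def BiMax_M_objective_def
        intro!: exI[of _ 1] exI[of _ \<Delta>])
qed


section \<open>Real random-access machine programs\<close>

text \<open>
  Algorithms are programs of a while-language over natural and real registers, one-dimensional
  arrays of naturals and two-dimensional arrays of reals. Control flow and addresses are computed
  from naturals by addition and truncated subtraction only. Real arithmetic, comparison and square
  root are exact unit-cost operations, the only real literals are integers, and there is neither a
  rounding operation nor any other conversion from reals to naturals. Every node of an expression
  and every command costs one unit. The operations are total as in HOL (\<open>x / 0 = 0\<close>,
  \<open>sqrt (- x) = - sqrt x\<close>); a program can always guard against these cases by a test.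
\<close>

type_synonym vname = string

datatype nexp =
    NConst nat
  | NReg vname
  | NArr vname nexp
  | NAdd nexp nexp
  | NSub nexp nexp

datatype rexp =
    RConst int
  | RReg vname
  | RArr vname nexp nexp
  | RAdd rexp rexp
  | RSub rexp rexp
  | RMul rexp rexp
  | RDiv rexp rexp
  | RSqrt rexp

datatype bexp =
    NLess nexp nexp
  | RLess rexp rexp
  | BNot bexp
  | BAnd bexp bexp

datatype com =
    Skip
  | NAssign vname nexp
  | NStore vname nexp nexp
  | RAssign vname rexp
  | RStore vname nexp nexp rexp
  | Seq com com
  | Cond bexp com com
  | While bexp com

record store =
  nreg :: "vname \<Rightarrow> nat"
  narr :: "vname \<Rightarrow> nat \<Rightarrow> nat"
  rreg :: "vname \<Rightarrow> real"
  rarr :: "vname \<Rightarrow> nat \<Rightarrow> nat \<Rightarrow> real"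

primrec nval :: "nexp \<Rightarrow> store \<Rightarrow> nat" where
  "nval (NConst m) s = m"
| "nval (NReg x) s = nreg s x"
| "nval (NArr x a) s = narr s x (nval a s)"
| "nval (NAdd a b) s = nval a s + nval b s"
| "nval (NSub a b) s = nval a s - nval b s"

primrec rval :: "rexp \<Rightarrow> store \<Rightarrow> real" where
  "rval (RConst c) s = of_int c"
| "rval (RReg x) s = rreg s x"
| "rval (RArr x a b) s = rarr s x (nval a s) (nval b s)"
| "rval (RAdd p q) s = rval p s + rval q s"
| "rval (RSub p q) s = rval p s - rval q s"
| "rval (RMul p q) s = rval p s * rval q s"
| "rval (RDiv p q) s = rval p s / rval q s"
| "rval (RSqrt p) s = sqrt (rval p s)"

primrec bval :: "bexp \<Rightarrow> store \<Rightarrow> bool" where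
  "bval (NLess a b) s \<longleftrightarrow> nval a s < nval b s"
| "bval (RLess p q) s \<longleftrightarrow> rval p s < rval q s"
| "bval (BNot b) s \<longleftrightarrow> \<not> bval b s"
| "bval (BAnd b c) s \<longleftrightarrow> bval b s \<and> bval c s"

primrec ncost :: "nexp \<Rightarrow> nat" where
  "ncost (NConst m) = 1"
| "ncost (NReg x) = 1"
| "ncost (NArr x a) = 1 + ncost a"
| "ncost (NAdd a b) = 1 + ncost a + ncost b"
| "ncost (NSub a b) = 1 + ncost a + ncost b"

primrec rcost :: "rexp \<Rightarrow> nat" where
  "rcost (RConst c) = 1"
| "rcost (RReg x) = 1"
| "rcost (RArr x a b) = 1 + ncost a + ncost b"
| "rcost (RAdd p q) = 1 + rcost p + rcost q"
| "rcost (RSub p q) = 1 + rcost p + rcost q"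
| "rcost (RMul p q) = 1 + rcost p + rcost q"
| "rcost (RDiv p q) = 1 + rcost p + rcost q"
| "rcost (RSqrt p) = 1 + rcost p"

primrec bcost :: "bexp \<Rightarrow> nat" where
  "bcost (NLess a b) = 1 + ncost a + ncost b"
| "bcost (RLess p q) = 1 + rcost p + rcost q"
| "bcost (BNot b) = 1 + bcost b"
| "bcost (BAnd b c) = 1 + bcost b + bcost c"

text \<open>\<open>exec c s t s'\<close>: started in \<open>s\<close>, the program \<open>c\<close> halts in \<open>s'\<close> after \<open>t\<close> time units.\<close>

inductive exec :: "com \<Rightarrow> store \<Rightarrow> nat \<Rightarrow> store \<Rightarrow> bool" where
  Skip: "exec Skip s 1 s"
| NAssign: "exec (NAssign x a) s (1 + ncost a)
    (s\<lparr>nreg := (nreg s)(x := nval a s)\<rparr>)"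
| NStore: "exec (NStore x i a) s (1 + ncost i + ncost a)
    (s\<lparr>narr := (narr s)(x := (narr s x)(nval i s := nval a s))\<rparr>)"
| RAssign: "exec (RAssign x p) s (1 + rcost p)
    (s\<lparr>rreg := (rreg s)(x := rval p s)\<rparr>)"
| RStore: "exec (RStore x i k p) s (1 + ncost i + ncost k + rcost p)
    (s\<lparr>rarr := (rarr s)(x := (rarr s x)(nval i s := (rarr s x (nval i s))(nval k s := rval p s)))\<rparr>)"
| Seq: "exec c1 s t1 s1 \<Longrightarrow> exec c2 s1 t2 s2 \<Longrightarrow> exec (Seq c1 c2) s (1 + t1 + t2) s2"
| CondTrue: "bval b s \<Longrightarrow> exec c1 s t s' \<Longrightarrow> exec (Cond b c1 c2) s (1 + bcost b + t) s'"
| CondFalse: "\<not> bval b s \<Longrightarrow> exec c2 s t s' \<Longrightarrow> exec (Cond b c1 c2) s (1 + bcost b + t) s'"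
| WhileFalse: "\<not> bval b s \<Longrightarrow> exec (While b c) s (1 + bcost b) s"
| WhileTrue: "bval b s \<Longrightarrow> exec c s t1 s1 \<Longrightarrow> exec (While b c) s1 t2 s2 \<Longrightarrow>
    exec (While b c) s (1 + bcost b + t1 + t2) s2"

text \<open>
  Programs are deterministic, so the existence of a run with some property is total correctness.
\<close>

lemma exec_deterministic:
  assumes "exec c s t s'" "exec c s u s''"
  shows "u = t \<and> s'' = s'"
  using assms
proof (induction arbitrary: u s'' rule: exec.induct)
  case (Seq c1 s t1 s1 c2 t2 s2)
  from Seq.prems obtain v1 r v2 where "exec c1 s v1 r" "exec c2 r v2 s''" "u = 1 + v1 + v2"
    by (cases rule: exec.cases) auto
  with Seq.IH show ?case by blast
next
  case (WhileTrue b s c t1 s1 t2 s2)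
  from WhileTrue.prems WhileTrue.hyps(1) obtain v1 r v2
    where "exec c s v1 r" "exec (While b c) r v2 s''" "u = 1 + bcost b + v1 + v2"
    by (cases rule: exec.cases) auto
  with WhileTrue.IH show ?case by blast
qed (erule exec.cases; fastforce)+

definition stores_mat :: "store \<Rightarrow> vname \<Rightarrow> real mat \<Rightarrow> bool" where
  "stores_mat s x A \<longleftrightarrow> (\<forall>i<dim_row A. \<forall>k<dim_col A. rarr s x i k = A $$ (i, k))"

text \<open>All registers and array cells not mentioned here initially have arbitrary contents.\<close>

definition holds_input ::
    "store \<Rightarrow> real mat \<Rightarrow> real mat \<Rightarrow> (nat \<Rightarrow> nat) \<Rightarrow> real mat \<Rightarrow> (nat \<Rightarrow> nat) \<Rightarrow> bool" where
  "holds_input s D QT YT QV YV \<longleftrightarrow>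
     nreg s ''n'' = dim_row D \<and> nreg s ''d'' = dim_col D \<and>
     nreg s ''nT'' = dim_row QT \<and> nreg s ''nV'' = dim_row QV \<and>
     stores_mat s ''D'' D \<and> stores_mat s ''QT'' QT \<and> stores_mat s ''QV'' QV \<and>
     (\<forall>j<dim_row QT. narr s ''YT'' j = YT j) \<and>
     (\<forall>j<dim_row QV. narr s ''YV'' j = YV j)"

end

theory Submission
  imports Defs "HOL-Library.Multiset"
begin

text \<open>
  The training objective is a constant plus the sum of \<open>G\<^sub>i \<bullet> \<Delta>\<^sub>i\<close>, so by the equality case of
  Cauchy--Schwarz every row with \<open>G\<^sub>i \<noteq> 0\<close> is forced to \<open>\<gamma> G\<^sub>i / \<parallel>G\<^sub>i\<parallel>\<close>, and only the scalar
  \<open>\<gamma>\<close> remains to be chosen. A validation query is then answered correctly iff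
  finitely many linear inequalities in \<open>\<gamma>\<close> hold, which describes an open interval. Sorting the
  lower and the upper endpoints separately, the number of intervals containing a point just to the
  right of the \<open>k\<close>-th lower endpoint \<open>L\<close> is the number of lower endpoints up to \<open>L\<close> minus the number
  of upper endpoints up to \<open>L\<close>, so a sweep with two pointers finds a point of maximal coverage,
  halfway between some \<open>L\<close> and the next upper endpoint.
\<close>

section \<open>Weakest preconditions with running time\<close>

text \<open>Sorting the two rows of endpoints separately forgets which endpoints belong together.
  The count survives this because it uses only the two multisets of endpoints and the fact that no
  interval is reversed; for that reason an empty interval is replaced by [1, 1] before sorting.
  Cauchy--Schwarz says nothing about a record whose gradient row vanishes: every vector in its ball
  is optimal for training. \<open>nudge_M\<close> leaves such records in place, so optimality is
  proved among the perturbations that do the same, and among all feasible ones when no gradient row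
  vanishes. The time bound and the machine shape the program. The gradient is accumulated query by
  query, at cost \<open>nT * d\<close>; work of order \<open>n * d\<close> is absorbed by
  \<open>nV * n * d\<close> since \<open>nV > 0\<close>; and sorting is bottom-up because the
  language has neither recursion nor halving of naturals, while doubling is an addition. Numerical
  constants are crude roundings, chosen so that bounds of nested loops stay products.\<close>

definition wp :: "com \<Rightarrow> store \<Rightarrow> (nat \<Rightarrow> store \<Rightarrow> bool) \<Rightarrow> bool" where
  "wp c s Q \<longleftrightarrow> (\<exists>t s'. exec c s t s' \<and> Q t s')"

lemma wp_mono:
  assumes "wp c s Q" "\<And>t s'. Q t s' \<Longrightarrow> Q' t s'"
  shows "wp c s Q'"
  using assms unfolding wp_def by blast

inductive_cases exec_SeqE: "exec (Seq c1 c2) s t s'"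
inductive_cases exec_CondE: "exec (Cond b c1 c2) s t s'"

text \<open>Determinism makes the one known run the only one, so the existential in
  \<open>wp\<close> collapses to an evaluation. As simp rules, these equivalences execute
  straight-line code symbolically and count its cost on the way.\<close>

lemma wp_exec: "exec c s t s' \<Longrightarrow> wp c s Q \<longleftrightarrow> Q t s'"
  unfolding wp_def using exec_deterministic by blast

lemmas wp_basic [simp] =
  wp_exec[OF exec.Skip] wp_exec[OF exec.NAssign] wp_exec[OF exec.RAssign] wp_exec[OF exec.RStore]

lemma wp_Seq [simp]:
  "wp (Seq c1 c2) s Q \<longleftrightarrow> wp c1 s (\<lambda>t1 s1. wp c2 s1 (\<lambda>t2 s2. Q (1 + t1 + t2) s2))"
  (is "?L \<longleftrightarrow> ?R")
proof
  assume ?L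
  then obtain t s' where "exec (Seq c1 c2) s t s'" "Q t s'" by (auto simp: wp_def)
  then show ?R by (elim exec_SeqE) (auto simp: wp_def)
next
  assume ?R
  then obtain t1 s1 t2 s2 where "exec c1 s t1 s1" "exec c2 s1 t2 s2" "Q (1 + t1 + t2) s2"
    by (auto simp: wp_def)
  then show ?L unfolding wp_def using exec.Seq by blast
qed

lemma wp_Cond [simp]:
  "wp (Cond b c1 c2) s Q \<longleftrightarrow>
    (if bval b s then wp c1 s (\<lambda>t. Q (1 + bcost b + t)) else wp c2 s (\<lambda>t. Q (1 + bcost b + t)))"
  (is "?L \<longleftrightarrow> ?R")
proof
  assume ?L
  then obtain t s' where "exec (Cond b c1 c2) s t s'" "Q t s'" by (auto simp: wp_def)
  then show ?R by (elim exec_CondE) (auto simp: wp_def)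
next
  assume R: ?R
  show ?L
  proof (cases "bval b s")
    case True
    with R obtain t s' where "exec c1 s t s'" "Q (1 + bcost b + t) s'" by (auto simp: wp_def)
    with True show ?thesis unfolding wp_def using exec.CondTrue by blast
  next
    case False
    with R obtain t s' where "exec c2 s t s'" "Q (1 + bcost b + t) s'" by (auto simp: wp_def)
    with False show ?thesis unfolding wp_def using exec.CondFalse by blast
  qed
qed

section \<open>Frames computed from the program text\<close>

primrec writes :: "com \<Rightarrow> vname set" where
  "writes Skip = {}"
| "writes (NAssign x a) = {x}"
| "writes (NStore x i a) = {x}"
| "writes (RAssign x p) = {x}"
| "writes (RStore x i k p) = {x}"
| "writes (Seq c1 c2) = writes c1 \<union> writes c2"
| "writes (Cond b c1 c2) = writes c1 \<union> writes c2"
| "writes (While b c) = writes c"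

text \<open>One set of names governs all four kinds of storage at once. This is coarse, but it
  allows the frame of a program to be read off its syntax.\<close>

definition agree :: "vname set \<Rightarrow> store \<Rightarrow> store \<Rightarrow> bool" where
  "agree V s s' \<longleftrightarrow> (\<forall>x. x \<notin> V \<longrightarrow>
     nreg s' x = nreg s x \<and> narr s' x = narr s x \<and> rreg s' x = rreg s x \<and> rarr s' x = rarr s x)"

lemma agree_refl [simp]: "agree V s s"
  by (simp add: agree_def)

lemma agree_trans: "agree V s s' \<Longrightarrow> agree V s' s'' \<Longrightarrow> agree V s s''"
  by (simp add: agree_def)

lemma agree_mono: "agree V s s' \<Longrightarrow> V \<subseteq> W \<Longrightarrow> agree W s s'"
  by (auto simp: agree_def)

lemma agreeD:
  assumes "agree V s s'" "x \<notin> V"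
  shows "nreg s' x = nreg s x" "narr s' x = narr s x" "rreg s' x = rreg s x" "rarr s' x = rarr s x"
  using assms by (simp_all add: agree_def)

lemma exec_agree: "exec c s t s' \<Longrightarrow> agree (writes c) s s'"
  by (induction rule: exec.induct) (auto simp: agree_def)

lemma wp_agree: "wp c s Q \<Longrightarrow> wp c s (\<lambda>t s'. Q t s' \<and> agree (writes c) s s')"
  unfolding wp_def using exec_agree by blast

text \<open>The first argument of \<open>I\<close> is a budget for the iterations still to come; it
  gives termination and the time bound together. The step may assume agreement with the initial
  store, so invariants need not carry the inputs that the body leaves alone.\<close>

lemma wp_While:
  assumes "I m s"
    and step: "\<And>k r. I k r \<Longrightarrow> bval b r \<Longrightarrow> agree (writes c) s r \<Longrightarrow>
      0 < k \<and> wp c r (\<lambda>t r'. t \<le> T \<and> I (k - 1) r')"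
  shows "wp (While b c) s (\<lambda>t s'. t \<le> m * (1 + bcost b + T) + 1 + bcost b \<and>
    (\<exists>k. I k s') \<and> \<not> bval b s' \<and> agree (writes c) s s')"
proof -
  have "\<exists>t s'. exec (While b c) r t s' \<and> t \<le> m * (1 + bcost b + T) + 1 + bcost b \<and>
      (\<exists>k. I k s') \<and> \<not> bval b s' \<and> agree (writes c) s s'"
    if "I m r" "agree (writes c) s r" for r
    using that
  proof (induction m arbitrary: r)
    case 0
    then have "\<not> bval b r" using step by blast
    with 0 show ?case
      by (intro exI[of _ "1 + bcost b"] exI[of _ r]) (auto intro: exec.WhileFalse[simplified])
  next
    case (Suc m)
    show ?case
    proof (cases "bval b r")
      case True
      with step[OF Suc.prems(1) _ Suc.prems(2)] obtain t1 r1
        where 1: "exec c r t1 r1" "t1 \<le> T" "I m r1"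
        by (auto simp: wp_def)
      have "agree (writes c) s r1"
        using exec_agree[OF 1(1)] Suc.prems(2) agree_trans by blast
      with Suc.IH[OF 1(3)] obtain t2 s'
        where 2: "exec (While b c) r1 t2 s'" "t2 \<le> m * (1 + bcost b + T) + 1 + bcost b"
          "\<exists>k. I k s'" "\<not> bval b s'" "agree (writes c) s s'"
        by blast
      have "exec (While b c) r (1 + bcost b + t1 + t2) s'"
        by (rule exec.WhileTrue[OF True 1(1) 2(1)])
      with 1(2) 2(2-) show ?thesis
        by (intro exI[of _ "1 + bcost b + t1 + t2"] exI[of _ s']) simp
    next
      case False
      with Suc.prems show ?thesis
        by (intro exI[of _ "1 + bcost b"] exI[of _ r]) (auto intro: exec.WhileFalse[simplified])
    qed
  qed
  with \<open>I m s\<close> show ?thesis unfolding wp_def by simp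
qed

definition For :: "vname \<Rightarrow> vname \<Rightarrow> com \<Rightarrow> com" where
  "For x u c = Seq (NAssign x (NConst 0))
     (While (NLess (NReg x) (NReg u)) (Seq c (NAssign x (NAdd (NReg x) (NConst 1)))))"

lemma writes_For [simp]: "writes (For x u c) = insert x (writes c)"
  by (auto simp: For_def)

text \<open>The invariant takes the iteration number as an argument and may not depend on the
  register \<open>x\<close> (premise \<open>stable\<close>), since the counter is incremented only
  after the body. Guard, increment and initialization give at most \<open>N * T + 9 * N + 7\<close>
  units; as \<open>N\<close> and \<open>T\<close> are positive, this is at most 17 times
  \<open>N * T\<close>.\<close>

lemma wp_For:
  assumes u: "u \<noteq> x" "u \<notin> writes c" and x: "x \<notin> writes c"
    and N: "nreg s u = N" "0 < N" and T: "0 < T"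
    and init: "I 0 s"
    and stable: "\<And>k r v. I k r \<Longrightarrow> I k (r\<lparr>nreg := (nreg r)(x := v)\<rparr>)"
    and step: "\<And>k r. I k r \<Longrightarrow> k < N \<Longrightarrow> nreg r x = k \<Longrightarrow> agree (insert x (writes c)) s r \<Longrightarrow>
      wp c r (\<lambda>t r'. t \<le> T \<and> I (Suc k) r')"
  shows "wp (For x u c) s (\<lambda>t s'. t \<le> 17 * N * T \<and> I N s' \<and> agree (insert x (writes c)) s s')"
proof -
  define s0 where "s0 = s\<lparr>nreg := (nreg s)(x := 0)\<rparr>"
  have s0: "agree (insert x (writes c)) s s0" by (simp add: s0_def agree_def)
  define b where "b = NLess (NReg x) (NReg u)"
  define body where "body = Seq c (NAssign x (NAdd (NReg x) (NConst 1)))"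
  define J where "J m r \<longleftrightarrow> (\<exists>k. k + m = N \<and> I k r \<and> nreg r x = k)" for m r
  have u_eq: "nreg r u = N" if "agree (writes body) s0 r" for r
    using that u N by (auto simp: agree_def s0_def body_def)
  have "wp (While b body) s0 (\<lambda>t s'. t \<le> N * (1 + bcost b + (T + 5)) + 1 + bcost b \<and>
    (\<exists>k. J k s') \<and> \<not> bval b s' \<and> agree (writes body) s0 s')"
  proof (rule wp_While)
    show "J N s0" using stable[OF init] by (simp add: J_def s0_def)
    fix m r
    assume "J m r" "bval b r" and ag: "agree (writes body) s0 r"
    then obtain k where k: "k + m = N" "I k r" "nreg r x = k" by (auto simp: J_def)
    from \<open>bval b r\<close> k u_eq[OF ag] have "k < N" by (simp add: b_def)
    moreover have "agree (insert x (writes c)) s r"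
      using agree_trans[OF s0] ag by (simp add: body_def)
    ultimately have "wp c r (\<lambda>t r'. t \<le> T \<and> I (Suc k) r')"
      using step k by blast
    then have "wp c r (\<lambda>t r'. (t \<le> T \<and> I (Suc k) r') \<and> agree (writes c) r r')"
      by (rule wp_agree)
    then have "wp body r (\<lambda>t r'. t \<le> T + 5 \<and> J (m - 1) r')"
      unfolding body_def wp_Seq
      by (rule wp_mono) (use k x \<open>k < N\<close> stable in \<open>auto simp: J_def agree_def\<close>)
    then show "0 < m \<and> wp body r (\<lambda>t r'. t \<le> T + 5 \<and> J (m - 1) r')"
      using k \<open>k < N\<close> by simp
  qed
  then have "wp (While b body) s0 (\<lambda>t s'. 3 + t \<le> 17 * N * T \<and> I N s' \<and>
      agree (insert x (writes c)) s s')"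
  proof (elim wp_mono, goal_cases)
    case (1 t s')
    then obtain k m where k: "k + m = N" "I k s'" "nreg s' x = k" by (auto simp: J_def)
    from 1 k u_eq have kN: "k = N" by (auto simp: b_def)
    have ag: "agree (insert x (writes c)) s s'"
      using 1 agree_trans[OF s0] by (simp add: body_def)
    have "N * 1 \<le> N * T" using T by (intro mult_le_mono2) simp
    moreover have "t \<le> N * T + 9 * N + 4"
      using 1 by (simp add: b_def algebra_simps)
    ultimately have "3 + t \<le> 17 * (N * T)" using \<open>0 < N\<close> by linarith
    then have "3 + t \<le> 17 * N * T" by simp
    with k kN ag show ?case by simp
  qed
  then show ?thesis
    by (simp add: For_def b_def body_def s0_def numeral_3_eq_3)
qed

section \<open>Bottom-up merge sort\<close>

text \<open>Blocks are aligned at multiples of \<open>w\<close>, and the last one is cut off at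
  \<open>m\<close>. Thus width 1 demands nothing and a width of at least \<open>m\<close> means that
  the whole array is sorted: these are the two ends of bottom-up merge sort.\<close>

definition sorted_blocks :: "nat \<Rightarrow> (nat \<Rightarrow> real) \<Rightarrow> nat \<Rightarrow> bool" where
  "sorted_blocks w A m \<longleftrightarrow>
     (\<forall>c p q. c * w \<le> p \<longrightarrow> p \<le> q \<longrightarrow> q < c * w + w \<longrightarrow> q < m \<longrightarrow> A p \<le> A q)"

lemma sorted_blocksD:
  "sorted_blocks w A m \<Longrightarrow> c * w \<le> p \<Longrightarrow> p \<le> q \<Longrightarrow> q < c * w + w \<Longrightarrow> q < m \<Longrightarrow> A p \<le> A q"
  unfolding sorted_blocks_def by blast

lemma sorted_blocks_1: "sorted_blocks 1 A m"
  unfolding sorted_blocks_def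
proof (intro allI impI)
  fix c p q :: nat
  assume "c * 1 \<le> p" "p \<le> q" "q < c * 1 + 1"
  then have "p = q" by simp
  then show "A p \<le> A q" by simp
qed

text \<open>Equality of these multisets expresses that one array section is a rearrangement of
  another without naming a permutation.\<close>

definition vals :: "(nat \<Rightarrow> real) \<Rightarrow> nat \<Rightarrow> nat \<Rightarrow> real multiset" where
  "vals A a b = image_mset A (mset_set {a..<b})"

lemma vals_Suc: "a \<le> b \<Longrightarrow> vals A a (Suc b) = add_mset (A b) (vals A a b)"
  by (simp add: vals_def atLeastLessThanSuc)

lemma vals_empty [simp]: "vals A a a = {#}"
  by (simp add: vals_def)

lemma vals_split:
  assumes "a \<le> b" "b \<le> c"
  shows "vals A a c = vals A a b + vals A b c"
  using assms(2,1) by (induction c rule: dec_induct) (auto simp: vals_Suc)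

lemma vals_cong: "(\<And>i. a \<le> i \<Longrightarrow> i < b \<Longrightarrow> A i = B i) \<Longrightarrow> vals A a b = vals B a b"
  unfolding vals_def by (intro image_mset_cong) auto

text \<open>
  While the blocks \<open>A[lo..<mid]\<close> and \<open>A[mid..<e]\<close> are merged into \<open>B[lo..<e]\<close>, the next
  elements to be compared are at \<open>i\<close> and \<open>j\<close>. The bounds \<open>mid\<close> and \<open>e\<close>
  may exceed the length \<open>m\<close> of the array.
\<close>

definition merging where
  "merging w A B m k i j mid e \<longleftrightarrow> (\<exists>c. let lo = c * (w + w) in
     mid = lo + w \<and> e = mid + w \<and> lo \<le> i \<and> i \<le> mid \<and> mid \<le> j \<and> j \<le> e \<and>
     j \<le> max m mid \<and> k + mid = i + j \<and> k \<le> m \<and>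
     vals B 0 k = vals A 0 i + vals A mid j \<and>
     sorted_blocks (w + w) B k \<and>
     (\<forall>p q. lo \<le> p \<longrightarrow> p < k \<longrightarrow> i \<le> q \<longrightarrow> q < mid \<longrightarrow> q < m \<longrightarrow> B p \<le> A q) \<and>
     (\<forall>p q. lo \<le> p \<longrightarrow> p < k \<longrightarrow> j \<le> q \<longrightarrow> q < e \<longrightarrow> q < m \<longrightarrow> B p \<le> A q))"

definition merged where
  "merged w A B k \<longleftrightarrow> (\<exists>c. k = c * (w + w)) \<and> vals B 0 k = vals A 0 k \<and> sorted_blocks (w + w) B k"

lemma merged_0: "merged w A B 0"
  by (auto simp: merged_def sorted_blocks_def)

lemma merging_start:
  assumes "merged w A B k" "k < m"
  shows "merging w A B m k k (k + w) (k + w) (k + w + w)"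
proof -
  from assms obtain c where "k = c * (w + w)" by (auto simp: merged_def)
  with assms show ?thesis
    unfolding merging_def merged_def Let_def by (intro exI[of _ c]) auto
qed

lemma sorted_blocks_append:
  assumes S: "sorted_blocks w B k" and c: "c * w \<le> k" "k < c * w + w"
    and le: "\<And>p. c * w \<le> p \<Longrightarrow> p < k \<Longrightarrow> B p \<le> v"
  shows "sorted_blocks w (B(k := v)) (Suc k)"
  unfolding sorted_blocks_def
proof (intro allI impI)
  fix c' p q
  assume *: "c' * w \<le> p" "p \<le> q" "q < c' * w + w" "q < Suc k"
  show "(B(k := v)) p \<le> (B(k := v)) q"
  proof (cases "q = k")
    case True
    \<comment> \<open>Position \<open>k\<close> lies both in block \<open>c\<close> and in block
      \<open>c'\<close>, so the two block numbers coincide.\<close>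
    have "c' * w < (c + 1) * w" "c * w < (c' + 1) * w" using * c True by simp_all
    then have "c' = c" by (simp only: mult_less_cancel2) simp
    with True * le show ?thesis by auto
  next
    case False
    with * sorted_blocksD[OF S *(1-3)] show ?thesis by auto
  qed
qed

lemma merging_step:
  assumes M: "merging w A B m k i j mid e" and k: "k < m" "k < e" and w: "0 < w"
    and A: "sorted_blocks w A m"
  shows "if i < mid \<and> \<not> (j < e \<and> j < m \<and> A j < A i)
    then merging w A (B(k := A i)) m (Suc k) (Suc i) j mid e
    else j < m \<and> merging w A (B(k := A j)) m (Suc k) i (Suc j) mid e"
proof -
  from M obtain c where c: "mid = c * (w + w) + w" "e = mid + w"
    and ij: "c * (w + w) \<le> i" "i \<le> mid" "mid \<le> j" "j \<le> e" "j \<le> max m mid" "k + mid = i + j"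
    and val: "vals B 0 k = vals A 0 i + vals A mid j"
    and S: "sorted_blocks (w + w) B k"
    and le1: "\<And>p q. c * (w + w) \<le> p \<Longrightarrow> p < k \<Longrightarrow> i \<le> q \<Longrightarrow> q < mid \<Longrightarrow> q < m \<Longrightarrow> B p \<le> A q"
    and le2: "\<And>p q. c * (w + w) \<le> p \<Longrightarrow> p < k \<Longrightarrow> j \<le> q \<Longrightarrow> q < e \<Longrightarrow> q < m \<Longrightarrow> B p \<le> A q"
    unfolding merging_def Let_def by blast
  have lok: "c * (w + w) \<le> k" "k < c * (w + w) + (w + w)" using c ij k by auto
  \<comment> \<open>Block \<open>c\<close> of the doubled width consists of the blocks
    \<open>2 * c\<close> and \<open>2 * c + 1\<close> of width \<open>w\<close>.\<close>
  have A1: "A p \<le> A q" if "c * (w + w) \<le> p" "p \<le> q" "q < mid" "q < m" for p q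
    using sorted_blocksD[OF A, of "2 * c" p q] that c by (simp add: algebra_simps)
  have A2: "A p \<le> A q" if "mid \<le> p" "p \<le> q" "q < e" "q < m" for p q
    using sorted_blocksD[OF A, of "2 * c + 1" p q] that c by (simp add: algebra_simps)
  have valk: "vals (B(k := v)) 0 (Suc k) = add_mset v (vals B 0 k)" for v
    using vals_cong[of 0 k "B(k := v)" B] by (simp add: vals_Suc)
  show ?thesis
  proof (cases "i < mid \<and> \<not> (j < e \<and> j < m \<and> A j < A i)")
    case True
    \<comment> \<open>If \<open>j = mid\<close>, then \<open>i = k\<close>; otherwise
      \<open>mid < j\<close> and hence \<open>j \<le> m\<close>, so that \<open>i < mid\<close>
      suffices.\<close>
    have im: "i < m" using ij True k by auto
    have j_le: "A i \<le> A q" if "j \<le> q" "q < e" "q < m" for q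
      using True A2[of j q] that ij by fastforce
    have "sorted_blocks (w + w) (B(k := A i)) (Suc k)"
      by (rule sorted_blocks_append[OF S lok]) (use le1 True im in auto)
    moreover have "vals (B(k := A i)) 0 (Suc k) = vals A 0 (Suc i) + vals A mid j"
      by (simp add: valk val vals_Suc)
    ultimately have "merging w A (B(k := A i)) m (Suc k) (Suc i) j mid e"
      unfolding merging_def Let_def using c ij True k j_le A1 le1 le2
      by (intro exI[of _ c]) auto
    with True show ?thesis by simp
  next
    case False
    have jm: "j < e" "j < m" using ij False k c by auto
    have i_le: "A j \<le> A q" if "i \<le> q" "q < mid" "q < m" for q
      using False A1[of i q] that ij jm by fastforce
    have "sorted_blocks (w + w) (B(k := A j)) (Suc k)"
      by (rule sorted_blocks_append[OF S lok]) (use le2 jm in auto)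
    moreover have "vals (B(k := A j)) 0 (Suc k) = vals A 0 i + vals A mid (Suc j)"
      using ij by (simp add: valk val vals_Suc)
    ultimately have "merging w A (B(k := A j)) m (Suc k) i (Suc j) mid e"
      unfolding merging_def Let_def using c ij False k i_le A2 le1 le2 jm
      by (intro exI[of _ c]) auto
    with False jm show ?thesis by auto
  qed
qed

lemma merging_finish:
  assumes M: "merging w A B m k i j mid e" and k: "k = e \<or> k = m"
  shows "vals B 0 k = vals A 0 k" "sorted_blocks (w + w) B k" "k = e \<Longrightarrow> merged w A B k"
proof -
  from M obtain c where c: "mid = c * (w + w) + w" "e = mid + w"
    and ij: "c * (w + w) \<le> i" "i \<le> mid" "mid \<le> j" "j \<le> e" "j \<le> max m mid" "k + mid = i + j"
    and val: "vals B 0 k = vals A 0 i + vals A mid j"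
    and S: "sorted_blocks (w + w) B k"
    unfolding merging_def Let_def by blast
  show v: "vals B 0 k = vals A 0 k"
  \<comment> \<open>If nothing was taken from the second block, then \<open>k = i\<close>. Otherwise
    \<open>mid < j \<le> m\<close>, and \<open>k\<close> can equal \<open>e\<close> or
    \<open>m\<close> only when the first block is exhausted, whence \<open>j = k\<close>.\<close>
  proof (cases "j = mid")
    case True
    with val ij show ?thesis by simp
  next
    case False
    then have "i = mid" "j = k" using k ij by auto
    with val vals_split[of 0 mid k A] ij show ?thesis by simp
  qed
  show "sorted_blocks (w + w) B k" by (fact S)
  assume "k = e"
  with c have "k = (c + 1) * (w + w)" by simp
  with v S show "merged w A B k" unfolding merged_def by blast
qed

section \<open>Merge passes as programs\<close>

definition merge_start :: com where
  "merge_start = Cond (NLess (NReg ''k'') (NReg ''e'')) Skip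
     (Seq (NAssign ''i'' (NReg ''k''))
     (Seq (NAssign ''mid'' (NAdd (NReg ''k'') (NReg ''w'')))
     (Seq (NAssign ''j'' (NReg ''mid''))
          (NAssign ''e'' (NAdd (NReg ''mid'') (NReg ''w''))))))"

definition merge_step :: "nat \<Rightarrow> com" where
  "merge_step r =
     Cond (BAnd (NLess (NReg ''i'') (NReg ''mid''))
             (BNot (BAnd (NLess (NReg ''j'') (NReg ''e''))
               (BAnd (NLess (NReg ''j'') (NReg ''nV''))
                 (RLess (RArr ''W'' (NConst r) (NReg ''j'')) (RArr ''W'' (NConst r) (NReg ''i'')))))))
       (Seq (RStore ''B'' (NConst 0) (NReg ''k'') (RArr ''W'' (NConst r) (NReg ''i'')))
            (NAssign ''i'' (NAdd (NReg ''i'') (NConst 1))))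
       (Seq (RStore ''B'' (NConst 0) (NReg ''k'') (RArr ''W'' (NConst r) (NReg ''j'')))
            (NAssign ''j'' (NAdd (NReg ''j'') (NConst 1))))"

text \<open>A pass is a single loop over the output position \<open>k\<close>; reaching
  \<open>e\<close> opens the next pair of blocks, and \<open>e = 0\<close> opens the first. The
  linear bound therefore comes from one use of \<open>wp_For\<close>, without adding up the lengths
  of inner loops.\<close>

definition merge_pass :: "nat \<Rightarrow> com" where
  "merge_pass r = Seq (NAssign ''e'' (NConst 0)) (For ''k'' ''nV'' (Seq merge_start (merge_step r)))"

definition copy_back :: "nat \<Rightarrow> com" where
  "copy_back r =
     For ''k'' ''nV'' (RStore ''W'' (NConst r) (NReg ''k'') (RArr ''B'' (NConst 0) (NReg ''k'')))"

definition sort_row :: "nat \<Rightarrow> com" where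
  "sort_row r = Seq (NAssign ''w'' (NConst 1))
     (While (NLess (NReg ''w'') (NReg ''nV''))
       (Seq (merge_pass r) (Seq (copy_back r) (NAssign ''w'' (NAdd (NReg ''w'') (NReg ''w''))))))"

lemma writes_merge_pass [simp]: "writes (merge_pass r) = {''e'', ''k'', ''i'', ''mid'', ''j'', ''B''}"
  by (auto simp: merge_pass_def merge_start_def merge_step_def)

lemma writes_copy_back [simp]: "writes (copy_back r) = {''k'', ''W''}"
  by (auto simp: copy_back_def)

lemma writes_sort_row [simp]:
  "writes (sort_row r) = {''w'', ''e'', ''k'', ''i'', ''mid'', ''j'', ''B'', ''W''}"
  by (auto simp: sort_row_def)

lemma wp_merge_pass:
  assumes m: "nreg s ''nV'' = m" "0 < m" and w: "nreg s ''w'' = w" "0 < w"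
    and S: "sorted_blocks w (rarr s ''W'' r) m"
  shows "wp (merge_pass r) s (\<lambda>t s'. t \<le> 1000 * m \<and>
    vals (rarr s' ''B'' 0) 0 m = vals (rarr s ''W'' r) 0 m \<and>
    sorted_blocks (w + w) (rarr s' ''B'' 0) m)"
proof -
  let ?A = "rarr s ''W'' r"
  define s0 where "s0 = s\<lparr>nreg := (nreg s)(''e'' := 0)\<rparr>"
  have s0: "nreg s0 ''nV'' = m" "nreg s0 ''w'' = w" "rarr s0 ''W'' = rarr s ''W''" "nreg s0 ''e'' = 0"
    using m w by (simp_all add: s0_def)
  \<comment> \<open>Either a pair of blocks was completed exactly at \<open>k\<close>, which the
    equation \<open>e = k\<close> signals to \<open>merge_start\<close>, or a merge is under
    way.\<close>
  define I where "I k q \<longleftrightarrow> (let B = rarr q ''B'' 0 in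
      merged w ?A B k \<and> nreg q ''e'' = k \<or>
      k < nreg q ''e'' \<and> merging w ?A B m k (nreg q ''i'') (nreg q ''j'') (nreg q ''mid'') (nreg q ''e''))"
    for k and q :: store
  have "wp (For ''k'' ''nV'' (Seq merge_start (merge_step r))) s0 (\<lambda>t s'. t \<le> 17 * m * 58 \<and> I m s' \<and>
      agree (insert ''k'' (writes (Seq merge_start (merge_step r)))) s0 s')"
  proof (rule wp_For)
    show "I 0 s0" by (simp add: I_def s0 merged_0)
    fix k and q :: store
    assume I: "I k q" and k: "k < m" "nreg q ''k'' = k"
      and ag: "agree (insert ''k'' (writes (Seq merge_start (merge_step r)))) s0 q"
    have q: "nreg q ''nV'' = m" "nreg q ''w'' = w" "rarr q ''W'' = rarr s ''W''"
      using agreeD[OF ag] s0 by (simp_all add: merge_start_def merge_step_def)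
    have start: "wp merge_start q (\<lambda>t q'. t \<le> 20 \<and> nreg q' ''k'' = k \<and> nreg q' ''nV'' = m \<and>
        rarr q' ''W'' = rarr s ''W'' \<and> k < nreg q' ''e'' \<and>
        merging w ?A (rarr q' ''B'' 0) m k (nreg q' ''i'') (nreg q' ''j'') (nreg q' ''mid'') (nreg q' ''e''))"
      using I k q w(2) merging_start[of w ?A "rarr q ''B'' 0" k m]
      by (auto simp: merge_start_def I_def Let_def)
    show "wp (Seq merge_start (merge_step r)) q (\<lambda>t q'. t \<le> 58 \<and> I (Suc k) q')"
      unfolding wp_Seq
    proof (rule wp_mono[OF start], elim conjE)
      fix t :: nat and q' :: store
      assume t: "t \<le> 20" and q': "nreg q' ''k'' = k" "nreg q' ''nV'' = m"
        "rarr q' ''W'' = rarr s ''W''" and ke: "k < nreg q' ''e''"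
        and M: "merging w ?A (rarr q' ''B'' 0) m k (nreg q' ''i'') (nreg q' ''j'') (nreg q' ''mid'') (nreg q' ''e'')"
      have fin: "merging w ?A B m (Suc k) i j mid e \<Longrightarrow> Suc k \<noteq> e \<Longrightarrow> k < e \<Longrightarrow> Suc k < e"
        "merging w ?A B m (Suc k) i j mid (Suc k) \<Longrightarrow> merged w ?A B (Suc k)" for i j mid e B
        by (auto intro: merging_finish(3))
      show "wp (merge_step r) q' (\<lambda>t2 s2. 1 + t + t2 \<le> 58 \<and> I (Suc k) s2)"
        using merging_step[OF M k(1) ke w(2) S] t ke fin
        by (cases "Suc k = nreg q' ''e''") (auto simp: merge_step_def I_def q' Let_def split: if_splits)
    qed
  qed (use m s0 in \<open>auto simp: merge_start_def merge_step_def I_def\<close>)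
  then have "wp (For ''k'' ''nV'' (Seq merge_start (merge_step r))) s0 (\<lambda>t s'. 3 + t \<le> 1000 * m \<and>
    vals (rarr s' ''B'' 0) 0 m = vals ?A 0 m \<and> sorted_blocks (w + w) (rarr s' ''B'' 0) m)"
  proof (elim wp_mono, goal_cases)
    case (1 t s')
    \<comment> \<open>The last pair may be cut off by the end of the array, so the loop can stop in
      the middle of a merge; \<open>merging_finish\<close> covers this with
      \<open>k = m\<close>.\<close>
    then have "vals (rarr s' ''B'' 0) 0 m = vals ?A 0 m" "sorted_blocks (w + w) (rarr s' ''B'' 0) m"
      using merging_finish[of w ?A "rarr s' ''B'' 0" m m]
      by (auto simp: I_def Let_def merged_def)
    with 1 m show ?case by simp
  qed
  then show ?thesis
    by (simp add: merge_pass_def s0_def numeral_3_eq_3)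
qed

lemma wp_copy_back:
  assumes m: "nreg s ''nV'' = m" "0 < m"
  shows "wp (copy_back r) s (\<lambda>t s'. t \<le> 1000 * m \<and>
    (\<forall>k<m. rarr s' ''W'' r k = rarr s ''B'' 0 k) \<and> (\<forall>r'. r' \<noteq> r \<longrightarrow> rarr s' ''W'' r' = rarr s ''W'' r'))"
proof -
  have "wp (copy_back r) s (\<lambda>t s'. t \<le> 17 * m * 10 \<and>
    ((\<forall>k<m. rarr s' ''W'' r k = rarr s ''B'' 0 k) \<and> (\<forall>r'. r' \<noteq> r \<longrightarrow> rarr s' ''W'' r' = rarr s ''W'' r')) \<and>
    agree (insert ''k'' (writes (RStore ''W'' (NConst r) (NReg ''k'') (RArr ''B'' (NConst 0) (NReg ''k''))))) s s')"
    unfolding copy_back_def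
    by (rule wp_For) (use m in \<open>auto simp: less_Suc_eq agree_def\<close>)
  then show ?thesis by (rule wp_mono) auto
qed

lemma wp_sort_row:
  assumes m: "nreg s ''nV'' = m" "0 < m"
  shows "wp (sort_row r) s (\<lambda>t s'. real t \<le> 3000 * real m * (log 2 (real m) + 1) \<and>
    vals (rarr s' ''W'' r) 0 m = vals (rarr s ''W'' r) 0 m \<and>
    (\<forall>p q. p \<le> q \<longrightarrow> q < m \<longrightarrow> rarr s' ''W'' r p \<le> rarr s' ''W'' r q) \<and>
    (\<forall>r'. r' \<noteq> r \<longrightarrow> rarr s' ''W'' r' = rarr s ''W'' r') \<and>
    agree (writes (sort_row r)) s s')"
proof -
  \<comment> \<open>The width is \<open>2 ^ x\<close> after \<open>x\<close> passes, so
    \<open>R\<close> is the number of passes. Being least, it exceeds the logarithm of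
    \<open>m\<close> by at most 1.\<close>
  define R where "R = (LEAST R. m \<le> 2 ^ R)"
  have R: "m \<le> 2 ^ R"
    unfolding R_def by (rule LeastI[of _ m]) (simp add: less_imp_le)
  have R_min: "2 ^ x < m" if "x < R" for x
    using not_less_Least[of x "\<lambda>R. m \<le> 2 ^ R"] that unfolding R_def by simp
  have Rlog: "real R \<le> log 2 (real m) + 1"
  proof (cases R)
    case 0
    with m show ?thesis by simp
  next
    case (Suc x)
    then have "2 ^ x < m" using R_min by simp
    then have "real (2 ^ x) < real m" by (simp only: of_nat_less_iff)
    then have "2 powr real x \<le> real m" by (simp add: powr_realpow)
    then have "real x \<le> log 2 (real m)" using m by (simp add: le_log_iff)
    with Suc show ?thesis by simp
  qed
  let ?body = "Seq (merge_pass r) (Seq (copy_back r) (NAssign ''w'' (NAdd (NReg ''w'') (NReg ''w''))))"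
  define s0 where "s0 = s\<lparr>nreg := (nreg s)(''w'' := 1)\<rparr>"
  define I where "I k q \<longleftrightarrow> (\<exists>x. x + k = R \<and> nreg q ''w'' = 2 ^ x) \<and> sorted_blocks (nreg q ''w'') (rarr q ''W'' r) m \<and>
     vals (rarr q ''W'' r) 0 m = vals (rarr s ''W'' r) 0 m \<and>
     (\<forall>r'. r' \<noteq> r \<longrightarrow> rarr q ''W'' r' = rarr s ''W'' r')" for k and q :: store
  have "wp (While (NLess (NReg ''w'') (NReg ''nV'')) ?body) s0
    (\<lambda>t s'. t \<le> R * (1 + bcost (NLess (NReg ''w'') (NReg ''nV'')) + (2000 * m + 10)) +
         1 + bcost (NLess (NReg ''w'') (NReg ''nV'')) \<and>
      (\<exists>k. I k s') \<and> \<not> bval (NLess (NReg ''w'') (NReg ''nV'')) s' \<and> agree (writes ?body) s0 s')"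
  proof (rule wp_While)
    show "I R s0" using sorted_blocks_1 by (auto simp: I_def s0_def)
    fix k and q :: store
    assume I: "I k q" and b: "bval (NLess (NReg ''w'') (NReg ''nV'')) q" and ag: "agree (writes ?body) s0 q"
    have q: "nreg q ''nV'' = m" using agreeD[OF ag] m by (simp add: s0_def)
    from I obtain x where x: "x + k = R" "nreg q ''w'' = 2 ^ x" by (auto simp: I_def)
    have k: "0 < k"
    proof (rule ccontr)
      assume "\<not> 0 < k"
      with x R b q show False by simp
    qed
    have S: "sorted_blocks (2 ^ x) (rarr q ''W'' r) m" using I x by (simp add: I_def)
    have "wp ?body q (\<lambda>t q'. t \<le> 2000 * m + 10 \<and> I (k - 1) q')"
      unfolding wp_Seq
    proof (rule wp_mono[OF wp_agree[OF wp_merge_pass[OF q m(2) x(2) _ S]]], simp, elim conjE)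
      fix t1 :: nat and q1 :: store
      assume t1: "t1 \<le> 1000 * m" and B1: "vals (rarr q1 ''B'' 0) 0 m = vals (rarr q ''W'' r) 0 m"
        "sorted_blocks (2 ^ x + 2 ^ x) (rarr q1 ''B'' 0) m" and ag1: "agree (writes (merge_pass r)) q q1"
      have q1: "nreg q1 ''nV'' = m" "nreg q1 ''w'' = 2 ^ x" "rarr q1 ''W'' = rarr q ''W''"
        using agreeD[OF ag1] q x by simp_all
      show "wp (copy_back r) q1 (\<lambda>t2 q2. wp (NAssign ''w'' (NAdd (NReg ''w'') (NReg ''w''))) q2
        (\<lambda>t3 q3. 1 + t1 + (1 + t2 + t3) \<le> 2000 * m + 10 \<and> I (k - 1) q3))"
      proof (rule wp_mono[OF wp_agree[OF wp_copy_back[OF q1(1) m(2)]]], elim conjE)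
        fix t2 :: nat and q2 :: store
        assume t2: "t2 \<le> 1000 * m" and W2: "\<forall>k<m. rarr q2 ''W'' r k = rarr q1 ''B'' 0 k"
          "\<forall>r'. r' \<noteq> r \<longrightarrow> rarr q2 ''W'' r' = rarr q1 ''W'' r'" and ag2: "agree (writes (copy_back r)) q1 q2"
        have w: "nreg q2 ''w'' = 2 ^ x" using agreeD[OF ag2] q1 by simp
        have "vals (rarr q2 ''W'' r) 0 m = vals (rarr q ''W'' r) 0 m"
          using vals_cong[of 0 m "rarr q2 ''W'' r" "rarr q1 ''B'' 0"] W2 B1 by simp
        moreover have "sorted_blocks (2 ^ x + 2 ^ x) (rarr q2 ''W'' r) m"
          using B1(2) W2(1) by (auto simp: sorted_blocks_def)
        moreover have "Suc x + (k - 1) = R" using x k by simp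
        ultimately have "I (k - 1) (q2\<lparr>nreg := (nreg q2)(''w'' := 2 ^ x + 2 ^ x)\<rparr>)"
          unfolding I_def using I W2(2) q1(3) by (intro conjI exI[of _ "Suc x"]) (simp_all add: I_def)
        with t1 t2 w show "wp (NAssign ''w'' (NAdd (NReg ''w'') (NReg ''w''))) q2
        (\<lambda>t3 q3. 1 + t1 + (1 + t2 + t3) \<le> 2000 * m + 10 \<and> I (k - 1) q3)"
          by simp
      qed
    qed
    with k show "0 < k \<and> wp ?body q (\<lambda>t q'. t \<le> 2000 * m + 10 \<and> I (k - 1) q')" by simp
  qed
  then have "wp (While (NLess (NReg ''w'') (NReg ''nV'')) ?body) s0
    (\<lambda>t s'. real (3 + t) \<le> 3000 * real m * (log 2 (real m) + 1) \<and>
    vals (rarr s' ''W'' r) 0 m = vals (rarr s ''W'' r) 0 m \<and>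
    (\<forall>p q. p \<le> q \<longrightarrow> q < m \<longrightarrow> rarr s' ''W'' r p \<le> rarr s' ''W'' r q) \<and>
    (\<forall>r'. r' \<noteq> r \<longrightarrow> rarr s' ''W'' r' = rarr s ''W'' r') \<and>
    agree (writes (sort_row r)) s s')"
  proof (elim wp_mono conjE, goal_cases)
    case (1 t s')
    have nV: "nreg s' ''nV'' = m" using agreeD[OF 1(4)] m by (simp add: s0_def)
    from 1(2) obtain k where I: "I k s'" by blast
    have mw: "m \<le> nreg s' ''w''" using 1(3) nV by simp
    have ag: "agree (writes (sort_row r)) s s'"
      using 1(4) unfolding agree_def by (auto simp: s0_def)
    \<comment> \<open>The width has reached \<open>m\<close>, so block 0 is the whole row.\<close>
    have "rarr s' ''W'' r p \<le> rarr s' ''W'' r q" if "p \<le> q" "q < m" for p q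
      using sorted_blocksD[of "nreg s' ''w''" "rarr s' ''W'' r" m 0 p q] that I mw by (simp add: I_def)
    moreover have "real (3 + t) \<le> 3000 * real m * (log 2 (real m) + 1)"
    proof -
      have "3 + t \<le> R * (2000 * m + 14) + 7" using 1(1) by (simp add: algebra_simps)
      then have "real (3 + t) \<le> real (R * (2000 * m + 14) + 7)" by (simp only: of_nat_le_iff)
      also have "\<dots> = real R * (2000 * real m + 14) + 7" by simp
      also have "\<dots> \<le> real R * (2014 * real m) + 7 * real m"
        using m(2) by (intro add_mono mult_left_mono) auto
      also have "\<dots> \<le> (log 2 (real m) + 1) * (2014 * real m) + 7 * real m"
        by (intro add_right_mono mult_right_mono Rlog) simp
      also have "\<dots> \<le> 3000 * real m * (log 2 (real m) + 1)"
      proof -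
        have "0 \<le> log 2 (real m)" using m by simp
        then have "0 \<le> real m * log 2 (real m)" by simp
        then show ?thesis by (simp add: algebra_simps)
      qed
      finally show ?thesis .
    qed
    ultimately show ?case using I ag by (simp add: I_def)
  qed
  then show ?thesis
    by (simp add: sort_row_def s0_def numeral_3_eq_3)
qed

section \<open>Sweeping the sorted endpoints\<close>

text \<open>If \<open>l i \<le> u i\<close> throughout, \<open>below l m y - below u m y\<close> is
  the number of half-open intervals from \<open>l i\<close> (included) to \<open>u i\<close>
  (excluded) that contain \<open>y\<close>. Replacing the first count by
  \<open>strictly_below\<close> gives a lower bound for the open intervals containing
  \<open>y\<close>.\<close>

definition below :: "(nat \<Rightarrow> real) \<Rightarrow> nat \<Rightarrow> real \<Rightarrow> nat" where
  "below A m y = card {i. i < m \<and> A i \<le> y}"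

definition strictly_below :: "(nat \<Rightarrow> real) \<Rightarrow> nat \<Rightarrow> real \<Rightarrow> nat" where
  "strictly_below A m y = card {i. i < m \<and> A i < y}"

definition sorted_upto :: "(nat \<Rightarrow> real) \<Rightarrow> nat \<Rightarrow> bool" where
  "sorted_upto A m \<longleftrightarrow> (\<forall>p q. p \<le> q \<longrightarrow> q < m \<longrightarrow> A p \<le> A q)"

lemma sorted_uptoD: "sorted_upto A m \<Longrightarrow> p \<le> q \<Longrightarrow> q < m \<Longrightarrow> A p \<le> A q"
  by (simp add: sorted_upto_def)

lemma below_mono: "y \<le> z \<Longrightarrow> below A m y \<le> below A m z"
  unfolding below_def by (intro card_mono) auto

lemma card_vals: "card {i. i < m \<and> P (A i)} = size (filter_mset P (vals A 0 m))"
proof (induction m)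
  case (Suc m)
  have "{i. i < Suc m \<and> P (A i)} = (if P (A m) then insert m {i. i < m \<and> P (A i)} else {i. i < m \<and> P (A i)})"
    by (auto simp: less_Suc_eq)
  with Suc show ?case by (simp add: vals_Suc)
qed simp

text \<open>This is what permits sorting the lower and the upper endpoints independently: the counts
  see only the multiset of values.\<close>

lemma below_cong: "vals A 0 m = vals B 0 m \<Longrightarrow> below A m = below B m"
  by (rule ext) (simp add: below_def card_vals[where P = "\<lambda>z. z \<le> _"])

lemma strictly_below_cong: "vals A 0 m = vals B 0 m \<Longrightarrow> strictly_below A m = strictly_below B m"
  by (rule ext) (simp add: strictly_below_def card_vals[where P = "\<lambda>z. z < _"])

lemma below_eq:
  assumes "sorted_upto B m" "p \<le> m" "\<And>p'. p' < p \<Longrightarrow> B p' \<le> y" "p < m \<Longrightarrow> y < B p"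
  shows "below B m y = p"
proof -
  have "{i. i < m \<and> B i \<le> y} = {..<p}"
  proof (intro equalityI subsetI)
    fix i assume i: "i \<in> {i. i < m \<and> B i \<le> y}"
    show "i \<in> {..<p}"
    proof (rule ccontr)
      assume "i \<notin> {..<p}"
      with i assms(4) sorted_uptoD[OF assms(1), of p i] show False by auto
    qed
  qed (use assms in auto)
  then show ?thesis by (simp add: below_def)
qed

lemma le_strictly_below:
  assumes "sorted_upto A m" "k < m" "A k < y"
  shows "Suc k \<le> strictly_below A m y"
proof -
  have "{..k} \<subseteq> {i. i < m \<and> A i < y}"
    using assms sorted_uptoD[OF assms(1)] by (auto intro: le_less_trans)
  from card_mono[OF _ this] show ?thesis by (simp add: strictly_below_def)
qed

text \<open>As \<open>y\<close> grows, \<open>below A\<close> increases only at values of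
  \<open>A\<close>, so it is enough to compare there. For equal values the premise is sharp only at
  the last index of the group; \<open>Max S\<close> is such an index.\<close>

lemma below_le:
  assumes A: "sorted_upto A m" and k: "\<And>k. k < m \<Longrightarrow> Suc k \<le> c + below B m (A k)"
  shows "below A m y \<le> c + below B m y"
proof (cases "{i. i < m \<and> A i \<le> y} = {}")
  case True
  then show ?thesis by (simp only: below_def) simp
next
  case False
  define S where "S = {i. i < m \<and> A i \<le> y}"
  have S: "finite S" "S \<noteq> {}" using False by (auto simp: S_def)
  then have "Max S \<in> S" by simp
  then have M: "Max S < m" "A (Max S) \<le> y" by (auto simp: S_def)
  have "S \<subseteq> {..Max S}" using S by auto
  from card_mono[OF _ this] have "below A m y \<le> Suc (Max S)"
    by (simp add: below_def S_def)
  also have "\<dots> \<le> c + below B m (A (Max S))" using k M by simp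
  also have "\<dots> \<le> c + below B m y" using M below_mono by simp
  finally show ?thesis .
qed

section \<open>The two-pointer sweep\<close>

definition sweep :: com where
  "sweep =
     Seq (NAssign ''k'' (NConst 0)) (Seq (NAssign ''p'' (NConst 0))
    (Seq (NAssign ''best'' (NConst 0)) (Seq (RAssign ''x'' (RConst 0))
    (While (NLess (NReg ''k'') (NReg ''nV''))
      (Cond (BAnd (NLess (NReg ''p'') (NReg ''nV''))
               (BNot (RLess (RArr ''W'' (NConst 0) (NReg ''k'')) (RArr ''W'' (NConst 1) (NReg ''p'')))))
         (NAssign ''p'' (NAdd (NReg ''p'') (NConst 1)))
         (Seq (Cond (NLess (NReg ''best'') (NSub (NAdd (NReg ''k'') (NConst 1)) (NReg ''p'')))
                (Seq (NAssign ''best'' (NSub (NAdd (NReg ''k'') (NConst 1)) (NReg ''p'')))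
                     (RAssign ''x'' (RDiv (RAdd (RArr ''W'' (NConst 0) (NReg ''k''))
                                                (RArr ''W'' (NConst 1) (NReg ''p''))) (RConst 2))))
                Skip)
              (NAssign ''k'' (NAdd (NReg ''k'') (NConst 1)))))))))"

lemma writes_sweep [simp]: "writes sweep = {''k'', ''p'', ''best'', ''x''}"
  by (auto simp: sweep_def)

text \<open>The witness \<open>c\<close> is the final value of \<open>best\<close>: it bounds the
  coverage of every point from above and that of \<open>x\<close> from below. The alternative
  \<open>c = 0\<close>, \<open>x = 0\<close> is the initial default; it survives when no candidate
  has positive coverage, and then every point is as good as any other.\<close>

lemma wp_sweep:
  assumes m: "nreg s ''nV'' = m" "0 < m"
    and A: "A = rarr s ''W'' 0" "sorted_upto A m" "\<And>i. i < m \<Longrightarrow> 0 \<le> A i"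
    and B: "B = rarr s ''W'' 1" "sorted_upto B m" "\<And>i. i < m \<Longrightarrow> B i \<le> 1"
  shows "wp sweep s (\<lambda>t s'. t \<le> 200 * m \<and>
    (let x = rreg s' ''x'' in \<exists>c. (\<forall>y. below A m y \<le> c + below B m y) \<and>
      (c = 0 \<and> x = 0 \<or> 0 < x \<and> x < 1 \<and> c + below B m x \<le> strictly_below A m x)))"
proof -
  define s0 where "s0 = s\<lparr>nreg := (nreg s)(''k'' := 0, ''p'' := 0, ''best'' := 0), rreg := (rreg s)(''x'' := 0)\<rparr>"
  define good where "good c x \<longleftrightarrow>
    c = 0 \<and> x = 0 \<or> 0 < x \<and> x < 1 \<and> c + below B m x \<le> strictly_below A m x" for c x
  \<comment> \<open>Each iteration advances \<open>k\<close> or \<open>p\<close>, so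
    \<open>(m - k) + (m - p)\<close> serves as the budget, starting at \<open>2 * m\<close>.\<close>
  define I where "I c q \<longleftrightarrow> (let k = nreg q ''k''; p = nreg q ''p''; b = nreg q ''best'' in
      k \<le> m \<and> p \<le> m \<and> c = (m - k) + (m - p) \<and> (k < m \<longrightarrow> (\<forall>p'<p. B p' \<le> A k)) \<and>
      (\<forall>k'<k. Suc k' \<le> b + below B m (A k')) \<and> good b (rreg q ''x''))" for c and q :: store
  let ?b = "NLess (NReg ''k'') (NReg ''nV'')"
  let ?body = "(Cond (BAnd (NLess (NReg ''p'') (NReg ''nV''))
               (BNot (RLess (RArr ''W'' (NConst 0) (NReg ''k'')) (RArr ''W'' (NConst 1) (NReg ''p'')))))
         (NAssign ''p'' (NAdd (NReg ''p'') (NConst 1)))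
         (Seq (Cond (NLess (NReg ''best'') (NSub (NAdd (NReg ''k'') (NConst 1)) (NReg ''p'')))
                (Seq (NAssign ''best'' (NSub (NAdd (NReg ''k'') (NConst 1)) (NReg ''p'')))
                     (RAssign ''x'' (RDiv (RAdd (RArr ''W'' (NConst 0) (NReg ''k''))
                                                (RArr ''W'' (NConst 1) (NReg ''p''))) (RConst 2))))
                Skip)
              (NAssign ''k'' (NAdd (NReg ''k'') (NConst 1)))))"
  have "wp (While ?b ?body) s0 (\<lambda>t s'. t \<le> 2 * m * (1 + bcost ?b + 60) + 1 + bcost ?b \<and>
      (\<exists>c. I c s') \<and> \<not> bval ?b s' \<and> agree (writes ?body) s0 s')"
  proof (rule wp_While)
    show "I (2 * m) s0" using m by (simp add: I_def s0_def good_def)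
    fix c and q :: store
    assume I: "I c q" and b: "bval ?b q" and ag: "agree (writes ?body) s0 q"
    have q: "nreg q ''nV'' = m" "rarr q ''W'' 0 = A" "rarr q ''W'' (Suc 0) = B"
      using agreeD[OF ag] m A B by (simp_all add: s0_def)
    define k p best x where kp: "k = nreg q ''k''" "p = nreg q ''p''" "best = nreg q ''best''" "x = rreg q ''x''"
    from b q have k: "k < m" by (simp add: kp)
    from I have I': "p \<le> m" "c = (m - k) + (m - p)" "\<And>p'. p' < p \<Longrightarrow> B p' \<le> A k"
      "\<And>k'. k' < k \<Longrightarrow> Suc k' \<le> best + below B m (A k')" "good best x"
      using k by (simp_all add: I_def Let_def kp)
    show "0 < c \<and> wp ?body q (\<lambda>t q'. t \<le> 60 \<and> I (c - 1) q')"
    proof (cases "p < m \<and> B p \<le> A k")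
      case True
      with I I' k show ?thesis
        by (auto simp: I_def Let_def q kp[symmetric] less_Suc_eq)
    next
      case False
      have p: "below B m (A k) = p"
        by (rule below_eq[OF B(2)]) (use I' False in auto)
      have next_le: "B p' \<le> A (Suc k)" if "p' < p" "Suc k < m" for p'
        using I'(3)[OF that(1)] sorted_uptoD[OF A(2), of k "Suc k"] that by simp
      have cand: "good (Suc k - p) ((A k + B p) / 2)" if "best < Suc k - p"
      proof -
        \<comment> \<open>With \<open>p = m\<close> the candidate value \<open>Suc k - p\<close>
          would be 0, so an improvement guarantees that a next upper endpoint exists.\<close>
        have pm: "p < m" using that k by simp
        with False have lt: "A k < B p" by simp
        \<comment> \<open>Any point strictly between the two endpoints would do:
          \<open>Suc k\<close> lower endpoints lie strictly below it and still only \<open>p\<close>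
          upper ones. The bounds on the endpoints put it inside (0, 1).\<close>
        define z where "z = (A k + B p) / 2"
        have z: "A k < z" "z < B p" using lt by (simp_all add: z_def)
        have "below B m z = p"
          by (rule below_eq[OF B(2)]) (use I' z in \<open>auto intro: order_trans[OF I'(3) less_imp_le]\<close>)
        moreover have "Suc k \<le> strictly_below A m z" using le_strictly_below[OF A(2) k z(1)] .
        moreover have "0 < z" "z < 1" using A(3)[OF k] B(3)[OF pm] z by linarith+
        ultimately show ?thesis using that by (simp add: good_def z_def)
      qed
      \<comment> \<open>Truncated subtraction does no harm, since
        \<open>Suc k \<le> (Suc k - p) + p\<close> holds even for \<open>p > Suc k\<close>.\<close>
      have "Suc k' \<le> (Suc k - p) + below B m (A k')" if "best < Suc k - p" "k' < Suc k" for k'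
        using that I'(4)[of k'] p by (auto simp: less_Suc_eq)
      moreover have "Suc k' \<le> best + below B m (A k')" if "\<not> best < Suc k - p" "k' < Suc k" for k'
        using that I'(4)[of k'] p by (auto simp: less_Suc_eq)
      ultimately show ?thesis using False I' k next_le cand
        by (auto simp: I_def Let_def q kp[symmetric])
    qed
  qed
  then have "wp (While ?b ?body) s0 (\<lambda>t s'. 12 + t \<le> 200 * m \<and>
    (let x = rreg s' ''x'' in \<exists>c. (\<forall>y. below A m y \<le> c + below B m y) \<and>
      (c = 0 \<and> x = 0 \<or> 0 < x \<and> x < 1 \<and> c + below B m x \<le> strictly_below A m x)))"
  proof (elim wp_mono conjE, goal_cases)
    case (1 t s')
    from 1(4) have "nreg s' ''nV'' = m" using m agreeD[OF 1(4)] by (simp add: s0_def)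
    with 1(2,3) have "\<forall>k'<m. Suc k' \<le> nreg s' ''best'' + below B m (A k')"
      "good (nreg s' ''best'') (rreg s' ''x'')"
      by (auto simp: I_def Let_def)
    with below_le[OF A(2)] 1(1) m show ?case
      unfolding Let_def good_def by (intro conjI exI[of _ "nreg s' ''best''"]) auto
  qed
  then show ?thesis
    by (simp add: sweep_def s0_def, elim wp_mono) auto
qed

section \<open>Intervals of correct answers\<close>

text \<open>The amount by which record \<open>y\<close> beats record \<open>j\<close> on query
  \<open>i\<close> is affine in the magnitude: \<open>D\<close> contributes the constant term
  \<open>a\<close> and the normalized gradient \<open>N\<close> the slope \<open>b\<close>. Both
  come out of one loop of length \<open>d\<close>.\<close>

definition margins :: com where
  "margins = Seq (RAssign ''a'' (RConst 0)) (Seq (RAssign ''b'' (RConst 0)) (For ''k'' ''d''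
     (Seq (RAssign ''a'' (RAdd (RReg ''a'') (RMul (RArr ''QV'' (NReg ''i'') (NReg ''k''))
             (RSub (RArr ''D'' (NReg ''y'') (NReg ''k'')) (RArr ''D'' (NReg ''j'') (NReg ''k''))))))
          (RAssign ''b'' (RAdd (RReg ''b'') (RMul (RArr ''QV'' (NReg ''i'') (NReg ''k''))
             (RSub (RArr ''N'' (NReg ''y'') (NReg ''k'')) (RArr ''N'' (NReg ''j'') (NReg ''k'')))))))))"

lemma writes_margins [simp]: "writes margins = {''a'', ''b'', ''k''}"
  by (auto simp: margins_def)

definition margin :: "store \<Rightarrow> vname \<Rightarrow> nat \<Rightarrow> nat \<Rightarrow> nat \<Rightarrow> real" where
  "margin s M i y j =
     (\<Sum>k<nreg s ''d''. rarr s ''QV'' i k * (rarr s M y k - rarr s M j k))"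

lemma wp_margins:
  assumes d: "0 < nreg s ''d''"
  shows "wp margins s (\<lambda>t s'. t \<le> 800 * nreg s ''d'' \<and>
    rreg s' ''a'' = margin s ''D'' (nreg s ''i'') (nreg s ''y'') (nreg s ''j'') \<and>
    rreg s' ''b'' = margin s ''N'' (nreg s ''i'') (nreg s ''y'') (nreg s ''j''))"
proof -
  let ?i = "nreg s ''i''" and ?y = "nreg s ''y''" and ?j = "nreg s ''j''"
  define s0 where "s0 = s\<lparr>rreg := (rreg s)(''a'' := 0, ''b'' := 0)\<rparr>"
  define body where "body = Seq (RAssign ''a'' (RAdd (RReg ''a'') (RMul (RArr ''QV'' (NReg ''i'') (NReg ''k''))
             (RSub (RArr ''D'' (NReg ''y'') (NReg ''k'')) (RArr ''D'' (NReg ''j'') (NReg ''k''))))))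
          (RAssign ''b'' (RAdd (RReg ''b'') (RMul (RArr ''QV'' (NReg ''i'') (NReg ''k''))
             (RSub (RArr ''N'' (NReg ''y'') (NReg ''k'')) (RArr ''N'' (NReg ''j'') (NReg ''k''))))))"
  define I where "I K q \<longleftrightarrow>
     rreg q ''a'' = (\<Sum>k<K. rarr s ''QV'' ?i k * (rarr s ''D'' ?y k - rarr s ''D'' ?j k)) \<and>
     rreg q ''b'' = (\<Sum>k<K. rarr s ''QV'' ?i k * (rarr s ''N'' ?y k - rarr s ''N'' ?j k))"
    for K and q :: store
  have "wp (For ''k'' ''d'' body) s0 (\<lambda>t s'. t \<le> 17 * nreg s ''d'' * 45 \<and> I (nreg s ''d'') s' \<and>
      agree (insert ''k'' (writes body)) s0 s')"
  proof (rule wp_For)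
    fix k and q :: store
    assume I: "I k q" and k: "nreg q ''k'' = k" and ag: "agree (insert ''k'' (writes body)) s0 q"
    have "nreg q ''i'' = ?i" "nreg q ''y'' = ?y" "nreg q ''j'' = ?j"
      "rarr q ''QV'' = rarr s ''QV''" "rarr q ''D'' = rarr s ''D''" "rarr q ''N'' = rarr s ''N''"
      using agreeD[OF ag] by (simp_all add: body_def s0_def)
    with I k show "wp body q (\<lambda>t q'. t \<le> 45 \<and> I (Suc k) q')"
      by (simp add: body_def I_def)
  qed (use d in \<open>auto simp: s0_def I_def body_def\<close>)
  then have "wp (For ''k'' ''d'' body) s0 (\<lambda>t s'. 6 + t \<le> 800 * nreg s ''d'' \<and>
    rreg s' ''a'' = margin s ''D'' ?i ?y ?j \<and> rreg s' ''b'' = margin s ''N'' ?i ?y ?j)"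
    by (rule wp_mono) (use d in \<open>auto simp: I_def margin_def\<close>)
  then show ?thesis
    by (simp add: margins_def body_def s0_def, elim wp_mono) auto
qed

text \<open>
  A linear inequality \<open>a + \<gamma> * b > 0\<close> in \<open>\<gamma> \<ge> 0\<close> becomes \<open>a + x * (b - a) > 0\<close>
  for \<open>x = \<gamma> / (1 + \<gamma>)\<close> in \<open>[0, 1)\<close>, so that all endpoints are finite. The weak lower bound
  in the necessary condition covers \<open>x = 0\<close>.
\<close>

definition bounds :: "real \<Rightarrow> real \<Rightarrow> (real \<Rightarrow> bool) \<Rightarrow> bool" where
  "bounds l u P \<longleftrightarrow> 0 \<le> l \<and> u \<le> 1 \<and> (\<forall>x. 0 \<le> x \<longrightarrow> x < 1 \<longrightarrow> P x \<longrightarrow> l \<le> x \<and> x < u) \<and>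
     (\<forall>x. l < x \<longrightarrow> x < u \<longrightarrow> P x)"

text \<open>The root \<open>r\<close> is computed before the sign of \<open>c\<close> is tested; if
  \<open>c\<close> is zero, no branch reads it. In that case the inequality is independent of the
  variable, and its failure empties the interval through \<open>u = 0\<close>, because lower
  endpoints are nonnegative.\<close>

definition narrow :: com where
  "narrow = Seq (RAssign ''c'' (RSub (RReg ''b'') (RReg ''a'')))
     (Seq (RAssign ''r'' (RDiv (RSub (RConst 0) (RReg ''a'')) (RReg ''c'')))
     (Cond (RLess (RConst 0) (RReg ''c''))
        (Cond (RLess (RReg ''l'') (RReg ''r'')) (RAssign ''l'' (RReg ''r'')) Skip)
     (Cond (RLess (RReg ''c'') (RConst 0))
        (Cond (RLess (RReg ''r'') (RReg ''u'')) (RAssign ''u'' (RReg ''r'')) Skip)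
     (Cond (RLess (RConst 0) (RReg ''a'')) Skip (RAssign ''u'' (RConst 0))))))"

lemma writes_narrow [simp]: "writes narrow = {''c'', ''r'', ''l'', ''u''}"
  by (auto simp: narrow_def)

lemma bounds_lower:
  assumes "bounds l u P" "a < b"
  shows "bounds (max l (- a / (b - a))) u (\<lambda>x. P x \<and> 0 < a + x * (b - a))"
proof -
  have "0 < a + x * (b - a) \<longleftrightarrow> - a / (b - a) < x" for x :: real
    using assms(2) by (simp add: field_simps)
  with assms(1) show ?thesis unfolding bounds_def by (auto simp: max_def)
qed

lemma bounds_upper:
  assumes "bounds l u P" "b < a"
  shows "bounds l (min u (- a / (b - a))) (\<lambda>x. P x \<and> 0 < a + x * (b - a))"
proof -
  have "0 < a + x * (b - a) \<longleftrightarrow> x < - a / (b - a)" for x :: real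
    using assms(2) by (simp add: field_simps)
  with assms(1) show ?thesis unfolding bounds_def by (auto simp: min_def)
qed

text \<open>Intersecting half-lines can produce \<open>u < l\<close>, which would spoil the count of
  lower minus upper endpoints. The replacement restores \<open>l \<le> u\<close> and stays valid
  since \<open>P\<close> fails on all of the half-open unit interval.\<close>

lemma bounds_empty: "bounds l u P \<Longrightarrow> \<not> l < u \<Longrightarrow> bounds 1 1 P"
  by (auto simp: bounds_def)

lemma wp_narrow:
  assumes "bounds (rreg s ''l'') (rreg s ''u'') P" "a = rreg s ''a''" "b = rreg s ''b''"
  shows "wp narrow s (\<lambda>t s'. t \<le> 60 \<and>
    bounds (rreg s' ''l'') (rreg s' ''u'') (\<lambda>x. P x \<and> 0 < a + x * (b - a)))"
proof -
  consider "a < b" | "b < a" | "a = b" by linarith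
  then show ?thesis
  proof cases
    case 1
    from bounds_lower[OF assms(1) this] 1 show ?thesis
      by (auto simp: narrow_def assms(2,3)[symmetric] max_def split: if_splits)
  next
    case 2
    from bounds_upper[OF assms(1) this] 2 show ?thesis
      by (auto simp: narrow_def assms(2,3)[symmetric] min_def split: if_splits)
  next
    case 3
    with assms show ?thesis
      by (auto simp: narrow_def bounds_def)
  qed
qed

section \<open>Endpoints for all validation queries\<close>

definition intervals :: com where
  "intervals = For ''i'' ''nV''
     (Seq (NAssign ''y'' (NArr ''YV'' (NReg ''i'')))
     (Seq (RAssign ''l'' (RConst 0)) (Seq (RAssign ''u'' (RConst 1))
     (Seq (For ''j'' ''n''
       (Cond (BAnd (BNot (NLess (NReg ''j'') (NReg ''y''))) (BNot (NLess (NReg ''y'') (NReg ''j''))))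
          Skip (Seq margins narrow)))
     (Seq (Cond (RLess (RReg ''l'') (RReg ''u'')) Skip
             (Seq (RAssign ''l'' (RConst 1)) (RAssign ''u'' (RConst 1))))
     (Seq (RStore ''W'' (NConst 0) (NReg ''i'') (RReg ''l''))
          (RStore ''W'' (NConst 1) (NReg ''i'') (RReg ''u''))))))))"

lemma writes_intervals [simp]: "writes intervals =
    {''i'', ''y'', ''l'', ''u'', ''j'', ''a'', ''b'', ''k'', ''c'', ''r'', ''W''}"
  by (auto simp: intervals_def)

text \<open>The bound \<open>J\<close> on the competing records makes this the invariant of the loop
  over \<open>j\<close>; with \<open>J = n\<close> it describes a correct answer.\<close>

definition correct_at :: "store \<Rightarrow> nat \<Rightarrow> nat \<Rightarrow> real \<Rightarrow> bool" where
  "correct_at s i J x \<longleftrightarrow> (let y = narr s ''YV'' i in \<forall>j<J. j \<noteq> y \<longrightarrow>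
     0 < margin s ''D'' i y j + x * (margin s ''N'' i y j - margin s ''D'' i y j))"

lemma wp_intervals:
  assumes n: "nreg s ''n'' = n" "0 < n" and d: "nreg s ''d'' = d" "0 < d"
    and m: "nreg s ''nV'' = m" "0 < m"
  shows "wp intervals s (\<lambda>t s'. t \<le> 300000 * m * (n * d) \<and>
    (\<forall>i<m. rarr s' ''W'' 0 i \<le> rarr s' ''W'' 1 i \<and>
       bounds (rarr s' ''W'' 0 i) (rarr s' ''W'' 1 i) (correct_at s i n)))"
proof -
  define inner where "inner = Cond (BAnd (BNot (NLess (NReg ''j'') (NReg ''y''))) (BNot (NLess (NReg ''y'') (NReg ''j''))))
          Skip (Seq margins narrow)"
  define body where "body =
     Seq (NAssign ''y'' (NArr ''YV'' (NReg ''i'')))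
     (Seq (RAssign ''l'' (RConst 0)) (Seq (RAssign ''u'' (RConst 1))
     (Seq (For ''j'' ''n'' inner)
     (Seq (Cond (RLess (RReg ''l'') (RReg ''u'')) Skip
             (Seq (RAssign ''l'' (RConst 1)) (RAssign ''u'' (RConst 1))))
     (Seq (RStore ''W'' (NConst 0) (NReg ''i'') (RReg ''l''))
          (RStore ''W'' (NConst 1) (NReg ''i'') (RReg ''u'')))))))"
  define I where "I K q \<longleftrightarrow> (\<forall>i<K. rarr q ''W'' 0 i \<le> rarr q ''W'' 1 i \<and>
       bounds (rarr q ''W'' 0 i) (rarr q ''W'' 1 i) (correct_at s i n))" for K and q :: store
  have wi: "writes inner = {''a'', ''b'', ''k'', ''c'', ''r'', ''l'', ''u''}"
    by (auto simp: inner_def)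
  have wb: "writes body = {''y'', ''l'', ''u'', ''j'', ''a'', ''b'', ''k'', ''c'', ''r'', ''W''}"
    by (auto simp: body_def wi)
  have nd: "0 < n * d" "d \<le> n * d" using n d by simp_all
  have "wp (For ''i'' ''nV'' body) s (\<lambda>t s'. t \<le> 17 * m * (16000 * (n * d)) \<and> I m s' \<and>
      agree (insert ''i'' (writes body)) s s')"
  proof (rule wp_For)
    fix i and q :: store
    assume I: "I i q" and i: "i < m" "nreg q ''i'' = i" and ag: "agree (insert ''i'' (writes body)) s q"
    have q: "nreg q ''n'' = n" "nreg q ''d'' = d" "narr q ''YV'' = narr s ''YV''"
      "rarr q ''QV'' = rarr s ''QV''" "rarr q ''D'' = rarr s ''D''" "rarr q ''N'' = rarr s ''N''"
      using agreeD[OF ag] n d by (simp_all add: wb)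
    define y where "y = narr s ''YV'' i"
    define q0 where "q0 = q\<lparr>nreg := (nreg q)(''y'' := y), rreg := (rreg q)(''l'' := 0, ''u'' := 1)\<rparr>"
    have "wp (For ''j'' ''n'' inner) q0 (\<lambda>t r. t \<le> 17 * n * (900 * d) \<and>
        bounds (rreg r ''l'') (rreg r ''u'') (correct_at s i n) \<and> agree (insert ''j'' (writes inner)) q0 r)"
    proof (rule wp_For)
      show "bounds (rreg q0 ''l'') (rreg q0 ''u'') (correct_at s i 0)"
        by (simp add: q0_def bounds_def correct_at_def)
      fix j and r :: store
      assume bd: "bounds (rreg r ''l'') (rreg r ''u'') (correct_at s i j)"
        and j: "j < n" "nreg r ''j'' = j" and ag': "agree (insert ''j'' (writes inner)) q0 r"
      have r: "nreg r ''d'' = d" "nreg r ''i'' = i" "nreg r ''y'' = y"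
        "rarr r ''QV'' = rarr s ''QV''" "rarr r ''D'' = rarr s ''D''" "rarr r ''N'' = rarr s ''N''"
        using agreeD[OF ag'] i q by (simp_all add: wi q0_def)
      have mr: "margin r M i y j = margin s M i y j" if "M = ''D'' \<or> M = ''N''" for M
        using that r d by (auto simp: margin_def)
      show "wp inner r (\<lambda>t r'. t \<le> 900 * d \<and>
          bounds (rreg r' ''l'') (rreg r' ''u'') (correct_at s i (Suc j)))"
      proof (cases "j = y")
        case True
        then have "correct_at s i (Suc j) = correct_at s i j"
          by (auto simp: correct_at_def y_def less_Suc_eq Let_def)
        with True bd r j d show ?thesis by (simp add: inner_def)
      next
        case False
        define a b where "a = margin s ''D'' i y j" and "b = margin s ''N'' i y j"
        have C: "correct_at s i (Suc j) = (\<lambda>x. correct_at s i j x \<and> 0 < a + x * (b - a))"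
          using False by (auto simp: correct_at_def y_def less_Suc_eq Let_def a_def b_def)
        have "wp margins r (\<lambda>t r'. wp narrow r' (\<lambda>t' r''. t + t' \<le> 800 * d + 60 \<and>
            bounds (rreg r'' ''l'') (rreg r'' ''u'') (correct_at s i (Suc j))))"
        proof (rule wp_mono[OF wp_agree[OF wp_margins]], use r d in simp, elim conjE)
          fix t :: nat and r' :: store
          assume t: "t \<le> 800 * nreg r ''d''" and ag'': "agree (writes margins) r r'"
            and "rreg r' ''a'' = margin r ''D'' (nreg r ''i'') (nreg r ''y'') (nreg r ''j'')"
              "rreg r' ''b'' = margin r ''N'' (nreg r ''i'') (nreg r ''y'') (nreg r ''j'')"
          then have ab: "a = rreg r' ''a''" "b = rreg r' ''b''"
            using mr r j by (simp_all add: a_def b_def)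
          have "bounds (rreg r' ''l'') (rreg r' ''u'') (correct_at s i j)"
            using bd agreeD[OF ag''] by simp
          from wp_narrow[OF this ab]
          show "wp narrow r' (\<lambda>t' r''. t + t' \<le> 800 * d + 60 \<and>
            bounds (rreg r'' ''l'') (rreg r'' ''u'') (correct_at s i (Suc j)))"
            unfolding C by (rule wp_mono) (use t r in auto)
        qed
        then have "wp (Seq margins narrow) r (\<lambda>t r''. 10 + t \<le> 900 * d \<and>
            bounds (rreg r'' ''l'') (rreg r'' ''u'') (correct_at s i (Suc j)))"
          unfolding wp_Seq by (rule wp_mono, elim wp_mono) (use d in auto)
        moreover have "\<not> bval (BAnd (BNot (NLess (NReg ''j'') (NReg ''y''))) (BNot (NLess (NReg ''y'') (NReg ''j'')))) r"
          using False r j by auto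
        ultimately show ?thesis
          by (simp only: inner_def wp_Cond if_False) (erule wp_mono, simp)
      qed
    qed (use n d q in \<open>auto simp: wi q0_def\<close>)
    \<comment> \<open>The summand 30 reserves time for the assignments, the repair of an empty
      interval and the two stores around the inner loop.\<close>
    then have loop: "wp (For ''j'' ''n'' inner) q0 (\<lambda>t r. 30 + t \<le> 16000 * (n * d) \<and>
        bounds (rreg r ''l'') (rreg r ''u'') (correct_at s i n) \<and> nreg r ''i'' = i \<and> rarr r ''W'' = rarr q ''W'')"
      by (rule wp_mono) (use i nd(1) in \<open>auto simp: agree_def wi q0_def simp del: nat_0_less_mult_iff\<close>)
    show "wp body q (\<lambda>t q'. t \<le> 16000 * (n * d) \<and> I (Suc i) q')"
      unfolding body_def
      using i q(3) I
      by (simp add: y_def[symmetric] q0_def[symmetric], intro wp_mono[OF loop])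
        (auto simp: I_def less_Suc_eq intro: bounds_empty)
  qed (use m nd in \<open>auto simp: I_def wb\<close>)
  then have "wp (For ''i'' ''nV'' body) s (\<lambda>t s'. t \<le> 300000 * m * (n * d) \<and> I m s')"
    by (rule wp_mono) auto
  then show ?thesis
    by (simp add: intervals_def body_def inner_def I_def)
qed

section \<open>Gradients and the output\<close>

definition fill_row :: "vname \<Rightarrow> vname \<Rightarrow> rexp \<Rightarrow> com" where
  "fill_row X y e = For ''k'' ''d'' (RStore X (NReg y) (NReg ''k'') e)"

lemma writes_fill_row [simp]: "writes (fill_row X y e) = {''k'', X}"
  by (simp add: fill_row_def)

text \<open>Premise \<open>f\<close> offers the old content of the cell about to be overwritten, so
  \<open>e\<close> may read that cell. In-place addition in \<open>accumulate\<close> relies on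
  this.\<close>

lemma wp_fill_row:
  assumes X: "X \<noteq> ''k''" "X \<noteq> ''d''" "X \<noteq> y" "y \<noteq> ''k''"
    and d: "nreg s ''d'' = d" "0 < d" and y: "nreg s y = a" and e: "rcost e \<le> 10"
    and f: "\<And>r b. b < d \<Longrightarrow> nreg r ''k'' = b \<Longrightarrow> agree {''k'', X} s r \<Longrightarrow>
      rarr r X a b = rarr s X a b \<Longrightarrow> rval e r = f b"
  shows "wp (fill_row X y e) s (\<lambda>t s'. t \<le> 300 * d \<and>
    (\<forall>i b. rarr s' X i b = (if i = a \<and> b < d then f b else rarr s X i b)) \<and> agree {''k'', X} s s')"
proof -
  have "wp (For ''k'' ''d'' (RStore X (NReg y) (NReg ''k'') e)) s (\<lambda>t s'. t \<le> 17 * d * 15 \<and>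
    (\<forall>i b. rarr s' X i b = (if i = a \<and> b < d then f b else rarr s X i b)) \<and>
    agree (insert ''k'' (writes (RStore X (NReg y) (NReg ''k'') e))) s s')"
  proof (rule wp_For)
    fix k and r :: store
    assume I: "\<forall>i b. rarr r X i b = (if i = a \<and> b < k then f b else rarr s X i b)"
      and k: "k < d" "nreg r ''k'' = k"
      and ag: "agree (insert ''k'' (writes (RStore X (NReg y) (NReg ''k'') e))) s r"
    have "rval e r = f k" using f[of k r] I k ag by simp
    moreover have "nreg r y = a" using agreeD[OF ag, of y] X y by simp
    ultimately show "wp (RStore X (NReg y) (NReg ''k'') e) r (\<lambda>t r'. t \<le> 15 \<and>
        (\<forall>i b. rarr r' X i b = (if i = a \<and> b < Suc k then f b else rarr s X i b)))"
      using I k e by (auto simp: less_Suc_eq)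
  qed (use X d in auto)
  then show ?thesis
    unfolding fill_row_def by (rule wp_mono) auto
qed

definition fill :: "vname \<Rightarrow> rexp \<Rightarrow> com" where
  "fill X e = For ''i'' ''n'' (fill_row X ''i'' e)"

lemma writes_fill [simp]: "writes (fill X e) = {''i'', ''k'', X}"
  by (simp add: fill_def)

lemma wp_fill:
  assumes X: "X \<noteq> ''k''" "X \<noteq> ''d''" "X \<noteq> ''i''" "X \<noteq> ''n''" and e: "rcost e \<le> 10"
    and d: "nreg s ''d'' = d" "0 < d" and n: "nreg s ''n'' = n" "0 < n"
    and f: "\<And>r a b. a < n \<Longrightarrow> b < d \<Longrightarrow> nreg r ''i'' = a \<Longrightarrow> nreg r ''k'' = b \<Longrightarrow>
      agree {''i'', ''k'', X} s r \<Longrightarrow> rval e r = f a b"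
  shows "wp (fill X e) s (\<lambda>t s'. t \<le> 6000 * (n * d) \<and> (\<forall>a<n. \<forall>b<d. rarr s' X a b = f a b))"
proof -
  have "wp (For ''i'' ''n'' (fill_row X ''i'' e)) s (\<lambda>t s'. t \<le> 17 * n * (300 * d) \<and>
    (\<forall>a<n. \<forall>b<d. rarr s' X a b = f a b) \<and> agree (insert ''i'' (writes (fill_row X ''i'' e))) s s')"
  proof (rule wp_For)
    fix i and r :: store
    assume I: "\<forall>a<i. \<forall>b<d. rarr r X a b = f a b" and i: "i < n" "nreg r ''i'' = i"
      and ag: "agree (insert ''i'' (writes (fill_row X ''i'' e))) s r"
    have "wp (fill_row X ''i'' e) r (\<lambda>t r'. t \<le> 300 * d \<and>
      (\<forall>i' b. rarr r' X i' b = (if i' = i \<and> b < d then f i b else rarr r X i' b)) \<and> agree {''k'', X} r r')"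
    proof (rule wp_fill_row)
      show "nreg r ''d'' = d" using agreeD[OF ag, of "''d''"] X d by simp
      fix q :: store and b
      assume q: "b < d" "nreg q ''k'' = b" "agree {''k'', X} r q"
      have "agree {''i'', ''k'', X} s q"
        using ag agree_mono[OF q(3), of "{''i'', ''k'', X}"] agree_trans by auto
      moreover have "nreg q ''i'' = i" using agreeD[OF q(3), of "''i''"] X i by simp
      ultimately show "rval e q = f i b" using f i q by blast
    qed (use X d e i in auto)
    then show "wp (fill_row X ''i'' e) r (\<lambda>t r'. t \<le> 300 * d \<and> (\<forall>a<Suc i. \<forall>b<d. rarr r' X a b = f a b))"
      by (rule wp_mono) (use I in \<open>auto simp: less_Suc_eq\<close>)
  qed (use X d n in auto)
  then show ?thesis
    unfolding fill_def by (rule wp_mono) auto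
qed

text \<open>Looping over the queries and adding each to the row of its ground truth touches
  \<open>nT * d\<close> cells; evaluating the defining sum for each row separately would take
  \<open>n * nT * d\<close> steps.\<close>

definition accumulate :: com where
  "accumulate = For ''i'' ''nT'' (Seq (NAssign ''y'' (NArr ''YT'' (NReg ''i'')))
     (fill_row ''G'' ''y'' (RAdd (RArr ''G'' (NReg ''y'') (NReg ''k'')) (RArr ''QT'' (NReg ''i'') (NReg ''k'')))))"

lemma writes_accumulate [simp]: "writes accumulate = {''i'', ''y'', ''k'', ''G''}"
  by (auto simp: accumulate_def)

lemma wp_accumulate:
  assumes d: "nreg s ''d'' = d" "0 < d" and m: "nreg s ''nT'' = m" "0 < m"
    and G: "\<forall>a<n. \<forall>b<d. rarr s ''G'' a b = 0"
  shows "wp accumulate s (\<lambda>t s'. t \<le> 6000 * (m * d) \<and>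
    (\<forall>a<n. \<forall>b<d. rarr s' ''G'' a b = (\<Sum>j<m. of_bool (a = narr s ''YT'' j) * rarr s ''QT'' j b)))"
proof -
  let ?e = "RAdd (RArr ''G'' (NReg ''y'') (NReg ''k'')) (RArr ''QT'' (NReg ''i'') (NReg ''k''))"
  let ?body = "Seq (NAssign ''y'' (NArr ''YT'' (NReg ''i''))) (fill_row ''G'' ''y'' ?e)"
  have "wp (For ''i'' ''nT'' ?body) s (\<lambda>t s'. t \<le> 17 * m * (310 * d) \<and>
    (\<forall>a<n. \<forall>b<d. rarr s' ''G'' a b = (\<Sum>j<m. of_bool (a = narr s ''YT'' j) * rarr s ''QT'' j b)) \<and>
    agree (insert ''i'' (writes ?body)) s s')"
  proof (rule wp_For)
    fix i and r :: store
    assume I: "\<forall>a<n. \<forall>b<d. rarr r ''G'' a b = (\<Sum>j<i. of_bool (a = narr s ''YT'' j) * rarr s ''QT'' j b)"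
      and i: "i < m" "nreg r ''i'' = i" and ag: "agree (insert ''i'' (writes ?body)) s r"
    have r: "nreg r ''d'' = d" "narr r ''YT'' = narr s ''YT''" "rarr r ''QT'' = rarr s ''QT''"
      using agreeD[OF ag] d by simp_all
    define y where "y = narr s ''YT'' i"
    define r0 where "r0 = r\<lparr>nreg := (nreg r)(''y'' := y)\<rparr>"
    have "wp (fill_row ''G'' ''y'' ?e) r0 (\<lambda>t r'. t \<le> 300 * d \<and>
      (\<forall>a b. rarr r' ''G'' a b = (if a = y \<and> b < d then rarr r ''G'' y b + rarr s ''QT'' i b else rarr r0 ''G'' a b)) \<and>
      agree {''k'', ''G''} r0 r')"
    proof (rule wp_fill_row)
      fix q :: store and b
      assume q: "b < d" "nreg q ''k'' = b" "agree {''k'', ''G''} r0 q" "rarr q ''G'' y b = rarr r0 ''G'' y b"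
      then show "rval ?e q = rarr r ''G'' y b + rarr s ''QT'' i b"
        using agreeD[OF q(3)] i r by (simp add: r0_def)
    qed (use d r in \<open>auto simp: r0_def\<close>)
    then have "wp (fill_row ''G'' ''y'' ?e) r0 (\<lambda>t r'. 5 + t \<le> 310 * d \<and>
      (\<forall>a<n. \<forall>b<d. rarr r' ''G'' a b = (\<Sum>j<Suc i. of_bool (a = narr s ''YT'' j) * rarr s ''QT'' j b)))"
      by (rule wp_mono) (use I d in \<open>auto simp: r0_def y_def\<close>)
    then show "wp ?body r (\<lambda>t r'. t \<le> 310 * d \<and>
      (\<forall>a<n. \<forall>b<d. rarr r' ''G'' a b = (\<Sum>j<Suc i. of_bool (a = narr s ''YT'' j) * rarr s ''QT'' j b)))"
      by (simp add: i r r0_def y_def, elim wp_mono) auto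
  qed (use d m G in auto)
  then show ?thesis
    unfolding accumulate_def by (rule wp_mono) auto
qed

text \<open>The division is left unguarded: a vanishing row gives \<open>0 / 0 = 0\<close>, the same
  convention as in \<open>nudge_M\<close>. Hence \<open>N\<close> is the perturbation of magnitude
  1, and every other magnitude only rescales it.\<close>

definition normalize_rows :: com where
  "normalize_rows = For ''i'' ''n'' (Seq (RAssign ''c'' (RConst 0))
     (Seq (For ''k'' ''d'' (RAssign ''c'' (RAdd (RReg ''c'')
         (RMul (RArr ''G'' (NReg ''i'') (NReg ''k'')) (RArr ''G'' (NReg ''i'') (NReg ''k''))))))
       (fill_row ''N'' ''i'' (RDiv (RArr ''G'' (NReg ''i'') (NReg ''k'')) (RSqrt (RReg ''c''))))))"

lemma writes_normalize_rows [simp]: "writes normalize_rows = {''i'', ''c'', ''k'', ''N''}"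
  by (auto simp: normalize_rows_def)

lemma wp_normalize_rows:
  assumes d: "nreg s ''d'' = d" "0 < d" and n: "nreg s ''n'' = n" "0 < n"
  shows "wp normalize_rows s (\<lambda>t s'. t \<le> 20000 * (n * d) \<and>
    (\<forall>a<n. \<forall>b<d. rarr s' ''N'' a b =
      rarr s ''G'' a b / sqrt (\<Sum>k<d. rarr s ''G'' a k * rarr s ''G'' a k)))"
proof -
  define norm2 where "norm2 a = (\<Sum>k<d. rarr s ''G'' a k * rarr s ''G'' a k)" for a
  let ?add = "RAssign ''c'' (RAdd (RReg ''c'')
         (RMul (RArr ''G'' (NReg ''i'') (NReg ''k'')) (RArr ''G'' (NReg ''i'') (NReg ''k''))))"
  let ?e = "RDiv (RArr ''G'' (NReg ''i'') (NReg ''k'')) (RSqrt (RReg ''c''))"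
  let ?body = "Seq (RAssign ''c'' (RConst 0)) (Seq (For ''k'' ''d'' ?add) (fill_row ''N'' ''i'' ?e))"
  have "wp (For ''i'' ''n'' ?body) s (\<lambda>t s'. t \<le> 17 * n * (700 * d) \<and>
    (\<forall>a<n. \<forall>b<d. rarr s' ''N'' a b = rarr s ''G'' a b / sqrt (norm2 a)) \<and>
    agree (insert ''i'' (writes ?body)) s s')"
  proof (rule wp_For)
    fix i and r :: store
    assume I: "\<forall>a<i. \<forall>b<d. rarr r ''N'' a b = rarr s ''G'' a b / sqrt (norm2 a)"
      and i: "i < n" "nreg r ''i'' = i" and ag: "agree (insert ''i'' (writes ?body)) s r"
    have r: "nreg r ''d'' = d" "rarr r ''G'' = rarr s ''G''"
      using agreeD[OF ag] d by simp_all
    define r0 where "r0 = r\<lparr>rreg := (rreg r)(''c'' := 0)\<rparr>"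
    have "wp (For ''k'' ''d'' ?add) r0 (\<lambda>t r'. t \<le> 17 * d * 15 \<and>
      rreg r' ''c'' = (\<Sum>k<d. rarr s ''G'' i k * rarr s ''G'' i k) \<and> agree (insert ''k'' (writes ?add)) r0 r')"
    proof (rule wp_For)
      fix k and q :: store
      assume "rreg q ''c'' = (\<Sum>k<k. rarr s ''G'' i k * rarr s ''G'' i k)" "nreg q ''k'' = k"
        and ag': "agree (insert ''k'' (writes ?add)) r0 q"
      then show "wp ?add q (\<lambda>t q'. t \<le> 15 \<and> rreg q' ''c'' = (\<Sum>k<Suc k. rarr s ''G'' i k * rarr s ''G'' i k))"
        using agreeD[OF ag'] i r by (simp add: r0_def)
    qed (use d r in \<open>auto simp: r0_def\<close>)
    then have "wp (For ''k'' ''d'' ?add) r0 (\<lambda>t1 r1. wp (fill_row ''N'' ''i'' ?e) r1 (\<lambda>t2 r2.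
      10 + t1 + t2 \<le> 700 * d \<and> (\<forall>a<Suc i. \<forall>b<d. rarr r2 ''N'' a b = rarr s ''G'' a b / sqrt (norm2 a))))"
    proof (elim wp_mono conjE)
      fix t1 :: nat and r1 :: store
      assume t1: "t1 \<le> 17 * d * 15" and c: "rreg r1 ''c'' = (\<Sum>k<d. rarr s ''G'' i k * rarr s ''G'' i k)"
        and ag1: "agree (insert ''k'' (writes ?add)) r0 r1"
      have r1: "nreg r1 ''d'' = d" "rarr r1 ''G'' = rarr s ''G''" "nreg r1 ''i'' = i" "rarr r1 ''N'' = rarr r ''N''"
        using agreeD[OF ag1] r i by (simp_all add: r0_def)
      have "wp (fill_row ''N'' ''i'' ?e) r1 (\<lambda>t r2. t \<le> 300 * d \<and>
        (\<forall>a b. rarr r2 ''N'' a b = (if a = i \<and> b < d then rarr s ''G'' i b / sqrt (norm2 i) else rarr r1 ''N'' a b)) \<and>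
        agree {''k'', ''N''} r1 r2)"
      proof (rule wp_fill_row)
        fix q :: store and b
        assume q: "b < d" "nreg q ''k'' = b" "agree {''k'', ''N''} r1 q"
        then show "rval ?e q = rarr s ''G'' i b / sqrt (norm2 i)"
          using agreeD[OF q(3)] r1 c by (simp add: norm2_def)
      qed (use d r1 in auto)
      then show "wp (fill_row ''N'' ''i'' ?e) r1 (\<lambda>t2 r2.
        10 + t1 + t2 \<le> 700 * d \<and> (\<forall>a<Suc i. \<forall>b<d. rarr r2 ''N'' a b = rarr s ''G'' a b / sqrt (norm2 a)))"
        by (rule wp_mono) (use I d t1 r1 in \<open>auto simp: less_Suc_eq\<close>)
    qed
    then show "wp ?body r (\<lambda>t r'. t \<le> 700 * d \<and>
        (\<forall>a<Suc i. \<forall>b<d. rarr r' ''N'' a b = rarr s ''G'' a b / sqrt (norm2 a)))"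
      by (simp add: r0_def, elim wp_mono) auto
  qed (use d n in auto)
  then show ?thesis
    unfolding normalize_rows_def norm2_def by (rule wp_mono) auto
qed

section \<open>Maximizers of the training objective\<close>

lemma euclid_norm_row:
  "i < dim_row A \<Longrightarrow> euclid_norm (row A i) = sqrt (\<Sum>k<dim_col A. A $$ (i, k) * A $$ (i, k))"
  by (simp add: euclid_norm_def scalar_prod_def lessThan_atLeast0)

text \<open>Both parts follow by expanding \<open>0 \<le> \<parallel>c v - \<parallel>v\<parallel> w\<parallel>\<^sup>2\<close>.\<close>

lemma inner_le_norm:
  fixes v w :: "nat \<Rightarrow> real"
  assumes "sqrt (\<Sum>k<d. w k * w k) \<le> c"
  shows "(\<Sum>k<d. v k * w k) \<le> c * sqrt (\<Sum>k<d. v k * v k)" (is "?vw \<le> c * ?v")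
    and "(\<Sum>k<d. v k * w k) = c * sqrt (\<Sum>k<d. v k * v k) \<Longrightarrow> k < d \<Longrightarrow> sqrt (\<Sum>k<d. v k * v k) * w k = c * v k"
proof -
  define V where "V = (\<Sum>k<d. v k * v k)"
  define W where "W = (\<Sum>k<d. w k * w k)"
  have V: "0 \<le> V" and W: "0 \<le> W" by (auto simp: V_def W_def intro: sum_nonneg)
  have c: "0 \<le> c" using order_trans[OF real_sqrt_ge_zero[OF W]] assms by (simp add: W_def)
  have Wc: "W \<le> c\<^sup>2" using assms by (simp add: W_def[symmetric] sqrt_le_D)
  have "(\<Sum>k<d. (c * v k - x * w k)\<^sup>2) =
      (\<Sum>k<d. c\<^sup>2 * (v k * v k) - 2 * c * x * (v k * w k) + x\<^sup>2 * (w k * w k))" for x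
    by (simp add: power2_eq_square algebra_simps)
  then have "(\<Sum>k<d. (c * v k - sqrt V * w k)\<^sup>2)
      = c\<^sup>2 * V - 2 * c * sqrt V * ?vw + (sqrt V)\<^sup>2 * W"
    by (simp only: sum.distrib sum_subtractf sum_distrib_left[symmetric] V_def[symmetric] W_def[symmetric])
  also have "\<dots> = c\<^sup>2 * V - 2 * c * sqrt V * ?vw + V * W" using V by simp
  also have "\<dots> \<le> c\<^sup>2 * V - 2 * c * sqrt V * ?vw + V * c\<^sup>2"
    using Wc V by (simp add: mult_left_mono)
  also have "\<dots> = 2 * c * sqrt V * (c * sqrt V - ?vw)"
    using V by (simp add: algebra_simps power2_eq_square)
  finally have sq: "(\<Sum>k<d. (c * v k - sqrt V * w k)\<^sup>2) \<le> 2 * c * sqrt V * (c * sqrt V - ?vw)" .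
  show "?vw \<le> c * ?v"
  \<comment> \<open>The factor \<open>2 * c * sqrt V\<close> can be cancelled only when it is
    positive; when it is zero, one of the two vectors vanishes.\<close>
  proof (cases "c = 0 \<or> V = 0")
    case True
    have "v k = 0" if "V = 0" "k < d" for k
      using that by (auto simp: V_def sum_nonneg_eq_0_iff)
    moreover have "w k = 0" if "c = 0" "k < d" for k
    proof -
      have "W = 0" using Wc W that by simp
      then show ?thesis using that by (auto simp: W_def sum_nonneg_eq_0_iff)
    qed
    ultimately have "?vw = 0" using True by (auto intro!: sum.neutral)
    then show ?thesis using c V by (simp add: V_def[symmetric])
  next
    case False
    then have "0 < 2 * c * sqrt V" using c V by simp
    moreover have "0 \<le> 2 * c * sqrt V * (c * sqrt V - ?vw)"
      using sq sum_nonneg[of "{..<d}" "\<lambda>k. (c * v k - sqrt V * w k)\<^sup>2"] by simp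
    ultimately have "0 \<le> c * sqrt V - ?vw" by (simp add: zero_le_mult_iff)
    then show ?thesis by (simp add: V_def)
  qed
  assume eq: "?vw = c * ?v" and k: "k < d"
  have "(\<Sum>k<d. (c * v k - sqrt V * w k)\<^sup>2) = 0"
    using sq sum_nonneg[of "{..<d}" "\<lambda>k. (c * v k - sqrt V * w k)\<^sup>2"] eq by (simp add: V_def)
  then have "(c * v k - sqrt V * w k)\<^sup>2 = 0" using k by (subst (asm) sum_nonneg_eq_0_iff) auto
  then show "?v * w k = c * v k" by (simp add: V_def)
qed

section \<open>Perturbations optimal for a fixed magnitude\<close>

locale nudge =
  fixes n d nT :: nat and D QT :: "real mat" and YT :: "nat \<Rightarrow> nat"
  assumes D: "D \<in> carrier_mat n d" and QT: "QT \<in> carrier_mat nT d"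
    and YT: "\<And>j. j < nT \<Longrightarrow> YT j < n"
begin

abbreviation "G \<equiv> train_gradient D QT YT"
abbreviation "nud \<equiv> nudge_M D QT YT"

lemma G_carrier [simp]: "G \<in> carrier_mat n d" "dim_row G = n" "dim_col G = d"
  using D by (auto simp: train_gradient_def)

lemma nud_carrier [simp]: "nud \<gamma> \<in> carrier_mat n d" "dim_row (nud \<gamma>) = n" "dim_col (nud \<gamma>) = d"
  using D by (auto simp: nudge_M_def Let_def)

lemma nud_index: "i < n \<Longrightarrow> k < d \<Longrightarrow> nud \<gamma> $$ (i, k) = \<gamma> * (G $$ (i, k) / euclid_norm (row G i))"
  using D by (auto simp: nudge_M_def Let_def)

lemma G_index: "i < n \<Longrightarrow> k < d \<Longrightarrow> G $$ (i, k) = (\<Sum>j<nT. of_bool (i = YT j) * QT $$ (j, k))"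
  using D QT by (auto simp: train_gradient_def)

definition gain :: "real mat \<Rightarrow> nat \<Rightarrow> real" where
  "gain \<Delta> i = (\<Sum>k<d. G $$ (i, k) * \<Delta> $$ (i, k))"

text \<open>Exchanging the sums collects the queries by their ground-truth record, which is how the
  rows of \<open>G\<close> arise. The objective splits into one linear term per row, so the rows can
  be maximized independently.\<close>

lemma train_score_eq:
  assumes \<Delta>: "\<Delta> \<in> carrier_mat n d"
  shows "train_score D QT YT \<Delta> = (\<Sum>j<nT. row QT j \<bullet> row D (YT j)) + (\<Sum>i<n. gain \<Delta> i)"
proof -
  have "(\<Sum>i<n. gain \<Delta> i) = (\<Sum>i<n. \<Sum>k<d. \<Sum>j<nT. of_bool (i = YT j) * (QT $$ (j, k) * \<Delta> $$ (i, k)))"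
    by (simp add: gain_def G_index sum_distrib_right mult.assoc)
  also have "\<dots> = (\<Sum>i<n. \<Sum>j<nT. \<Sum>k<d. of_bool (i = YT j) * (QT $$ (j, k) * \<Delta> $$ (i, k)))"
    by (intro sum.cong refl sum.swap)
  also have "\<dots> = (\<Sum>j<nT. \<Sum>i<n. \<Sum>k<d. of_bool (i = YT j) * (QT $$ (j, k) * \<Delta> $$ (i, k)))"
    by (rule sum.swap)
  also have "\<dots> = (\<Sum>j<nT. \<Sum>i<n. if i = YT j then \<Sum>k<d. QT $$ (j, k) * \<Delta> $$ (i, k) else 0)"
    by (intro sum.cong refl) auto
  also have "\<dots> = (\<Sum>j<nT. \<Sum>k<d. QT $$ (j, k) * \<Delta> $$ (YT j, k))"
    by (rule sum.cong[OF refl]) (use YT in \<open>simp add: sum.delta\<close>)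
  also have "\<dots> = (\<Sum>j<nT. row QT j \<bullet> row \<Delta> (YT j))"
    using YT QT \<Delta> by (intro sum.cong refl) (simp add: scalar_prod_def lessThan_atLeast0)
  finally have g: "(\<Sum>i<n. gain \<Delta> i) = (\<Sum>j<nT. row QT j \<bullet> row \<Delta> (YT j))" .
  have "train_score D QT YT \<Delta> = (\<Sum>j<nT. row QT j \<bullet> row D (YT j) + row QT j \<bullet> row \<Delta> (YT j))"
    unfolding train_score_def
    using QT D \<Delta> YT by (intro sum.cong) (auto intro!: scalar_prod_add_distrib[where n = d])
  with g show ?thesis by (simp add: sum.distrib)
qed

lemma bounded_iff:
  "bounded_magnitude D \<gamma> \<Delta> \<longleftrightarrow> \<Delta> \<in> carrier_mat n d \<and> (\<forall>i<n. euclid_norm (row \<Delta> i) \<le> \<gamma>)"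
  using D by (auto simp: bounded_magnitude_def)

lemma gain_le:
  assumes "\<Delta> \<in> carrier_mat n d" "i < n" "euclid_norm (row \<Delta> i) \<le> \<gamma>"
  shows "gain \<Delta> i \<le> \<gamma> * euclid_norm (row G i)"
    and "gain \<Delta> i = \<gamma> * euclid_norm (row G i) \<Longrightarrow> k < d \<Longrightarrow>
      euclid_norm (row G i) * \<Delta> $$ (i, k) = \<gamma> * G $$ (i, k)"
  using assms inner_le_norm[of "\<lambda>k. \<Delta> $$ (i, k)" d \<gamma> "\<lambda>k. G $$ (i, k)"]
  by (auto simp: gain_def euclid_norm_row)

lemma euclid_norm_G_eq_0:
  assumes "i < n"
  shows "euclid_norm (row G i) = 0 \<longleftrightarrow> row G i = 0\<^sub>v d"
proof -
  have "row G i = 0\<^sub>v d \<longleftrightarrow> (\<forall>k<d. G $$ (i, k) = 0)"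
    using assms by (auto simp: vec_eq_iff)
  then show ?thesis
    using assms by (auto simp: euclid_norm_row sum_nonneg_eq_0_iff)
qed

text \<open>This is the Cauchy--Schwarz bound of \<open>gain_le\<close>, attained. At a vanishing
  row both sides are 0, again by \<open>0 / 0 = 0\<close>.\<close>

lemma gain_nud: "i < n \<Longrightarrow> gain (nud \<gamma>) i = \<gamma> * euclid_norm (row G i)"
proof -
  assume i: "i < n"
  have "gain (nud \<gamma>) i = \<gamma> * ((\<Sum>k<d. G $$ (i, k) * G $$ (i, k)) / euclid_norm (row G i))"
    using i by (simp add: gain_def nud_index sum_distrib_left sum_divide_distrib mult.left_commute)
  also have "(\<Sum>k<d. G $$ (i, k) * G $$ (i, k)) = (euclid_norm (row G i))\<^sup>2"
    using i by (simp add: euclid_norm_row sum_nonneg)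
  finally show ?thesis by (simp add: power2_eq_square)
qed

lemma norm_nud:
  assumes "i < n" "0 \<le> \<gamma>"
  shows "euclid_norm (row (nud \<gamma>) i) \<le> \<gamma>"
proof -
  define g where "g = euclid_norm (row G i)"
  have g2: "(\<Sum>k<d. G $$ (i, k) * G $$ (i, k)) = g\<^sup>2"
    using assms by (simp add: g_def euclid_norm_row sum_nonneg)
  have "euclid_norm (row (nud \<gamma>) i) = sqrt (\<Sum>k<d. (\<gamma> / g)\<^sup>2 * (G $$ (i, k) * G $$ (i, k)))"
    using assms by (simp add: euclid_norm_row nud_index g_def[symmetric] power2_eq_square algebra_simps)
  also have "\<dots> = sqrt ((\<gamma> / g)\<^sup>2 * g\<^sup>2)"
    by (simp add: sum_distrib_left[symmetric] g2)
  also have "\<dots> \<le> \<gamma>"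
    using assms by (cases "g = 0") (simp_all add: power_divide)
  finally show ?thesis .
qed

lemma nud_mem_MaxS_M:
  assumes "0 \<le> \<gamma>"
  shows "nud \<gamma> \<in> MaxS_M D QT YT \<gamma>"
proof -
  have "train_score D QT YT \<Delta> \<le> train_score D QT YT (nud \<gamma>)" if "bounded_magnitude D \<gamma> \<Delta>" for \<Delta>
  proof -
    have "(\<Sum>i<n. gain \<Delta> i) \<le> (\<Sum>i<n. gain (nud \<gamma>) i)"
      using that by (intro sum_mono) (auto simp: bounded_iff gain_nud intro: gain_le)
    with that show ?thesis by (simp add: train_score_eq bounded_iff)
  qed
  with assms show ?thesis
    by (auto simp: MaxS_M_def is_arg_max_linorder bounded_iff norm_nud)
qed

text \<open>Comparison with \<open>nud \<gamma>\<close> shows that the total slack in the row bounds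
  is at most 0. Every slack is nonnegative, so each row attains equality, and a nonzero norm of the
  gradient row can be divided out.\<close>

lemma MaxS_M_index:
  assumes \<gamma>: "0 \<le> \<gamma>" and \<Delta>: "\<Delta> \<in> MaxS_M D QT YT \<gamma>"
    and i: "i < n" "row G i \<noteq> 0\<^sub>v d" and k: "k < d"
  shows "\<Delta> $$ (i, k) = nud \<gamma> $$ (i, k)"
proof -
  from \<Delta> have b: "\<Delta> \<in> carrier_mat n d" "\<And>i. i < n \<Longrightarrow> euclid_norm (row \<Delta> i) \<le> \<gamma>"
    and opt: "train_score D QT YT (nud \<gamma>) \<le> train_score D QT YT \<Delta>"
    using nud_mem_MaxS_M[OF \<gamma>] by (auto simp: MaxS_M_def is_arg_max_linorder bounded_iff)
  have le: "gain \<Delta> i \<le> \<gamma> * euclid_norm (row G i)" if "i < n" for i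
    using gain_le(1)[OF b(1) that b(2)[OF that]] .
  have "(\<Sum>i<n. \<gamma> * euclid_norm (row G i) - gain \<Delta> i) \<le> 0"
    using opt b(1) by (simp add: train_score_eq sum_subtractf gain_nud)
  moreover have "0 \<le> \<gamma> * euclid_norm (row G i) - gain \<Delta> i" if "i < n" for i
    using le[OF that] by simp
  ultimately have "(\<Sum>i<n. \<gamma> * euclid_norm (row G i) - gain \<Delta> i) = 0"
    by (intro antisym sum_nonneg) auto
  then have "gain \<Delta> i = \<gamma> * euclid_norm (row G i)"
    using le i by (subst (asm) sum_nonneg_eq_0_iff) auto
  from gain_le(2)[OF b(1) i(1) b(2)[OF i(1)] this k]
  have "euclid_norm (row G i) * \<Delta> $$ (i, k) = \<gamma> * G $$ (i, k)" .
  moreover have "euclid_norm (row G i) \<noteq> 0" using euclid_norm_G_eq_0 i by simp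
  ultimately show ?thesis using i k by (simp add: nud_index field_simps)
qed

text \<open>This turns the bi-level problem into a search over the single number
  \<open>\<gamma>\<close>: the curve of matrices \<open>nud \<gamma>\<close> is the whole restricted
  feasible set.\<close>

lemma feasible_iff:
  "BiMax_M_feasible D QT YT (\<gamma>, \<Delta>) \<and> fixes_untrained D QT YT (\<gamma>, \<Delta>) \<longleftrightarrow> 0 \<le> \<gamma> \<and> \<Delta> = nud \<gamma>"
proof
  assume A: "BiMax_M_feasible D QT YT (\<gamma>, \<Delta>) \<and> fixes_untrained D QT YT (\<gamma>, \<Delta>)"
  then have \<gamma>: "0 \<le> \<gamma>" and M: "\<Delta> \<in> MaxS_M D QT YT \<gamma>" by (auto simp: BiMax_M_feasible_def)
  from M have c: "\<Delta> \<in> carrier_mat n d" by (auto simp: MaxS_M_def is_arg_max_def bounded_iff)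
  have "\<Delta> $$ (i, k) = nud \<gamma> $$ (i, k)" if "i < n" "k < d" for i k
  proof (cases "row G i = 0\<^sub>v d")
    case True
    with A that have "row \<Delta> i = 0\<^sub>v d" using D by (auto simp: fixes_untrained_def)
    then have "row \<Delta> i $ k = 0\<^sub>v d $ k" "row G i $ k = 0\<^sub>v d $ k" using True by simp_all
    with that c show ?thesis by (simp add: nud_index)
  next
    case False
    with MaxS_M_index[OF \<gamma> M] that show ?thesis by simp
  qed
  with \<gamma> c show "0 \<le> \<gamma> \<and> \<Delta> = nud \<gamma>" by (auto intro!: eq_matI)
next
  assume A: "0 \<le> \<gamma> \<and> \<Delta> = nud \<gamma>"
  moreover have "row (nud \<gamma>) i = 0\<^sub>v d" if "i < n" "row G i = 0\<^sub>v d" for i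
  proof -
    have "G $$ (i, k) = 0" if "k < d" for k
      using arg_cong[OF \<open>row G i = 0\<^sub>v d\<close>, of "\<lambda>v. v $ k"] that \<open>i < n\<close> by simp
    with that show ?thesis by (auto simp: vec_eq_iff nud_index)
  qed
  ultimately show "BiMax_M_feasible D QT YT (\<gamma>, \<Delta>) \<and> fixes_untrained D QT YT (\<gamma>, \<Delta>)"
    using nud_mem_MaxS_M D by (auto simp: BiMax_M_feasible_def fixes_untrained_def)
qed

text \<open>In the second part \<open>fixes_untrained\<close> is vacuous, so the restricted and the
  full feasible set coincide. With a vanishing row this can fail, as
  \<open>nudge_M_suboptimal_with_vanishing_row\<close> shows.\<close>

lemma arg_max_nud:
  assumes "0 \<le> \<gamma>" and max: "\<And>\<gamma>'. 0 \<le> \<gamma>' \<Longrightarrow> val_score D QV YV (nud \<gamma>') \<le> val_score D QV YV (nud \<gamma>)"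
  shows "is_arg_max (BiMax_M_objective D QV YV)
      (\<lambda>x. BiMax_M_feasible D QT YT x \<and> fixes_untrained D QT YT x) (\<gamma>, nud \<gamma>)"
    and "(\<forall>i<n. row G i \<noteq> 0\<^sub>v d) \<Longrightarrow> BiMax_M_optimal D QT YT QV YV (\<gamma>, nud \<gamma>)"
proof -
  show *: "is_arg_max (BiMax_M_objective D QV YV)
      (\<lambda>x. BiMax_M_feasible D QT YT x \<and> fixes_untrained D QT YT x) (\<gamma>, nud \<gamma>)"
    unfolding is_arg_max_linorder split_paired_All feasible_iff
    using assms by (auto simp: BiMax_M_objective_def)
  assume "\<forall>i<n. row G i \<noteq> 0\<^sub>v d"
  then have "(\<lambda>x. BiMax_M_feasible D QT YT x \<and> fixes_untrained D QT YT x) = BiMax_M_feasible D QT YT"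
    using D by (auto simp: fixes_untrained_def fun_eq_iff)
  with * show "BiMax_M_optimal D QT YT QV YV (\<gamma>, nud \<gamma>)"
    by (simp add: BiMax_M_optimal_def)
qed

end

section \<open>Optimality of the sweep and the program\<close>

lemma vals_mem:
  assumes "vals A 0 m = vals B 0 m" "i < m"
  obtains j where "j < m" "A i = B j"
proof -
  have "A ` {0..<m} = B ` {0..<m}"
    using arg_cong[OF assms(1), of set_mset] by (simp add: vals_def)
  with assms(2) show ?thesis using that by fastforce
qed

text \<open>At any \<open>y\<close>, the queries answered correctly and those with
  \<open>u i \<le> y\<close> are disjoint and all have \<open>l i \<le> y\<close>; for the latter
  this needs \<open>l i \<le> u i\<close>. At \<open>x\<close>, conversely, each query with
  \<open>l i < x\<close> is answered correctly or has \<open>u i \<le> x\<close>. The two counts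
  meet at \<open>c\<close>.\<close>

lemma sweep_optimal:
  assumes lu: "\<And>i. i < m \<Longrightarrow> l i \<le> u i" and C: "\<And>i. i < m \<Longrightarrow> bounds (l i) (u i) (C i)"
    and c: "\<And>y. below l m y \<le> c + below u m y"
    and x: "c = 0 \<and> x = 0 \<or> 0 < x \<and> x < 1 \<and> c + below u m x \<le> strictly_below l m x"
    and y: "0 \<le> y" "y < 1"
  shows "card {i. i < m \<and> C i y} \<le> card {i. i < m \<and> C i x}"
proof -
  have "card {i. i < m \<and> C i y} + below u m y = card ({i. i < m \<and> C i y} \<union> {i. i < m \<and> u i \<le> y})"
    unfolding below_def by (rule card_Un_disjoint[symmetric]) (use C y in \<open>force simp: bounds_def\<close>)+
  also have "\<dots> \<le> below l m y"
    unfolding below_def by (rule card_mono) (use lu C y in \<open>force simp: bounds_def\<close>)+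
  also have "\<dots> \<le> c + below u m y" by (rule c)
  finally have "card {i. i < m \<and> C i y} \<le> c" by simp
  also have "c \<le> card {i. i < m \<and> C i x}"
  proof (cases "c = 0")
    case False
    then have "c + below u m x \<le> strictly_below l m x" using x by blast
    also have "\<dots> \<le> card ({i. i < m \<and> C i x} \<union> {i. i < m \<and> u i \<le> x})"
      unfolding strictly_below_def
      by (rule card_mono) (use C in \<open>force simp: bounds_def\<close>)+
    also have "\<dots> \<le> card {i. i < m \<and> C i x} + below u m x"
      unfolding below_def by (rule card_Un_le)
    finally show ?thesis by simp
  qed simp
  finally show ?thesis .
qed

lemma (in nudge) val_correct_nud:
  assumes QV: "QV \<in> carrier_mat nV d" and i: "i < nV" "YV i < n"
    and s: "nreg s ''d'' = d" "stores_mat s ''QV'' QV" "stores_mat s ''D'' D" "narr s ''YV'' i = YV i"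
    and N: "\<And>a b. a < n \<Longrightarrow> b < d \<Longrightarrow> rarr s ''N'' a b = G $$ (a, b) / euclid_norm (row G a)"
    and x: "x < 1"
  shows "val_correct D QV YV (nud (x / (1 - x))) i \<longleftrightarrow> correct_at s i n x"
proof -
  define \<gamma> where "\<gamma> = x / (1 - x)"
  have score: "row QV i \<bullet> (row D j + row (nud \<gamma>) j) =
      (\<Sum>k<d. rarr s ''QV'' i k * (rarr s ''D'' j k + \<gamma> * rarr s ''N'' j k))" if "j < n" for j
    unfolding scalar_prod_def using that QV D i s(2,3)
    by (auto simp: lessThan_atLeast0 nud_index N stores_mat_def intro!: sum.cong)
  have diff: "row QV i \<bullet> (row D (YV i) + row (nud \<gamma>) (YV i)) - row QV i \<bullet> (row D j + row (nud \<gamma>) j) =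
      margin s ''D'' i (YV i) j + \<gamma> * margin s ''N'' i (YV i) j" if "j < n" for j
    by (simp add: score that i margin_def s(1) sum_subtractf[symmetric] sum_distrib_left
        sum.distrib[symmetric] algebra_simps)
  \<comment> \<open>The change of variable multiplies the inequality by the positive factor
    \<open>1 - x\<close>.\<close>
  have transform: "0 < a + \<gamma> * b \<longleftrightarrow> 0 < a + x * (b - a)" for a b
  proof -
    have "a + x * (b - a) = (1 - x) * (a + \<gamma> * b)"
      using x by (simp add: \<gamma>_def field_simps)
    then show ?thesis using x by (simp add: zero_less_mult_iff)
  qed
  have "val_correct D QV YV (nud \<gamma>) i \<longleftrightarrow>
      (\<forall>j<n. j \<noteq> YV i \<longrightarrow> 0 < margin s ''D'' i (YV i) j + \<gamma> * margin s ''N'' i (YV i) j)"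
    unfolding val_correct_def using D by (auto simp: diff[symmetric])
  then show ?thesis
    by (simp add: correct_at_def Let_def s(4) transform \<gamma>_def[symmetric])
qed

section \<open>The assembled program\<close>

definition nudge_program :: com where
  "nudge_program = Seq (fill ''G'' (RConst 0)) (Seq accumulate (Seq normalize_rows (Seq intervals
     (Seq (sort_row 0) (Seq (sort_row 1) (Seq sweep
     (Seq (RAssign ''g'' (RDiv (RReg ''x'') (RSub (RConst 1) (RReg ''x''))))
          (fill ''Delta'' (RMul (RReg ''g'') (RArr ''N'' (NReg ''i'') (NReg ''k'')))))))))))"

theorem theorem2:
  shows "\<exists>(NUDGE_M :: com) (C :: real).
    \<forall>(n::nat) (d::nat) (nT::nat) (nV::nat)
      (D :: real mat) (QT :: real mat) (QV :: real mat) (YT :: nat \<Rightarrow> nat) (YV :: nat \<Rightarrow> nat)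
      (s :: store).
      n > 0 \<and> d > 0 \<and> nT > 0 \<and> nV > 0 \<and>
      D \<in> carrier_mat n d \<and> QT \<in> carrier_mat nT d \<and> QV \<in> carrier_mat nV d \<and>
      (\<forall>j<nT. YT j < n) \<and> (\<forall>j<nV. YV j < n) \<and>
      holds_input s D QT YT QV YV
      \<longrightarrow>
      (\<exists>(t::nat) (s' :: store) (\<gamma>::real).
        exec NUDGE_M s t s' \<and>
        real t \<le> C * (real nV * (real n * real d + log 2 (real nV)) + real nT * real d) \<and>
        stores_mat s' ''Delta'' (nudge_M D QT YT \<gamma>) \<and>
        ((\<forall>i<n. row (train_gradient D QT YT) i \<noteq> 0\<^sub>v d) \<longrightarrow>
           BiMax_M_optimal D QT YT QV YV (\<gamma>, nudge_M D QT YT \<gamma>)) \<and>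
        is_arg_max (BiMax_M_objective D QV YV)
          (\<lambda>x. BiMax_M_feasible D QT YT x \<and> fixes_untrained D QT YT x)
          (\<gamma>, nudge_M D QT YT \<gamma>))"
proof (rule exI[of _ nudge_program], rule exI[of _ 400000], intro allI impI, elim conjE)
  fix n d nT nV :: nat and D QT QV :: "real mat" and YT YV :: "nat \<Rightarrow> nat" and s :: store
  assume pos: "n > 0" "d > 0" "nT > 0" "nV > 0"
    and D: "D \<in> carrier_mat n d" and QT: "QT \<in> carrier_mat nT d" and QV: "QV \<in> carrier_mat nV d"
    and YT: "\<forall>j<nT. YT j < n" and YV: "\<forall>j<nV. YV j < n"
    and inp: "holds_input s D QT YT QV YV"
  interpret nudge n d nT D QT YT
    using D QT YT by unfold_locales auto
  have s: "nreg s ''n'' = n" "nreg s ''d'' = d" "nreg s ''nT'' = nT" "nreg s ''nV'' = nV"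
      "stores_mat s ''D'' D" "stores_mat s ''QT'' QT" "stores_mat s ''QV'' QV"
      "\<And>j. j < nT \<Longrightarrow> narr s ''YT'' j = YT j" "\<And>j. j < nV \<Longrightarrow> narr s ''YV'' j = YV j"
    using inp D QT QV by (auto simp: holds_input_def)
  have QTs: "rarr s ''QT'' j b = QT $$ (j, b)" if "j < nT" "b < d" for j b
    using s(6) that QT by (auto simp: stores_mat_def)

  have "wp (fill ''G'' (RConst 0)) s (\<lambda>t s'. t \<le> 6000 * (n * d) \<and> (\<forall>a<n. \<forall>b<d. rarr s' ''G'' a b = 0))"
    by (rule wp_fill) (use s pos in auto)
  then obtain t1 s1 where e1: "exec (fill ''G'' (RConst 0)) s t1 s1" and t1: "t1 \<le> 6000 * (n * d)"
    and G1: "\<forall>a<n. \<forall>b<d. rarr s1 ''G'' a b = 0"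
    unfolding wp_def by blast
  note f1 = agreeD[OF exec_agree[OF e1]]

  have "nreg s1 ''d'' = d" "nreg s1 ''nT'' = nT" using f1 s by simp_all
  from wp_accumulate[OF this(1) pos(2) this(2) pos(3) G1]
  obtain t2 s2 where e2: "exec accumulate s1 t2 s2" and t2: "t2 \<le> 6000 * (nT * d)"
    and G2: "\<forall>a<n. \<forall>b<d. rarr s2 ''G'' a b = (\<Sum>j<nT. of_bool (a = narr s1 ''YT'' j) * rarr s1 ''QT'' j b)"
    unfolding wp_def by blast
  note f2 = agreeD[OF exec_agree[OF e2]]
  have G: "rarr s2 ''G'' a b = G $$ (a, b)" if "a < n" "b < d" for a b
    using that G2 f1 s(8) QTs by (simp add: G_index)

  have "nreg s2 ''d'' = d" "nreg s2 ''n'' = n" using f2 f1 s by simp_all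
  from wp_normalize_rows[OF this(1) pos(2) this(2) pos(1)]
  obtain t3 s3 where e3: "exec normalize_rows s2 t3 s3" and t3: "t3 \<le> 20000 * (n * d)"
    and N3: "\<forall>a<n. \<forall>b<d. rarr s3 ''N'' a b =
      rarr s2 ''G'' a b / sqrt (\<Sum>k<d. rarr s2 ''G'' a k * rarr s2 ''G'' a k)"
    unfolding wp_def by blast
  note f3 = agreeD[OF exec_agree[OF e3]]
  have N: "rarr s3 ''N'' a b = G $$ (a, b) / euclid_norm (row G a)" if "a < n" "b < d" for a b
    using that N3 by (simp add: G euclid_norm_row)

  have s3: "nreg s3 ''n'' = n" "nreg s3 ''d'' = d" "nreg s3 ''nV'' = nV"
    "rarr s3 ''D'' = rarr s ''D''" "rarr s3 ''QV'' = rarr s ''QV''" "narr s3 ''YV'' = narr s ''YV''"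
    using f3 f2 f1 s by simp_all
  from wp_intervals[OF s3(1) pos(1) s3(2) pos(2) s3(3) pos(4)]
  obtain t4 s4 where e4: "exec intervals s3 t4 s4" and t4: "t4 \<le> 300000 * nV * (n * d)"
    and W4: "\<forall>i<nV. rarr s4 ''W'' 0 i \<le> rarr s4 ''W'' 1 i \<and>
       bounds (rarr s4 ''W'' 0 i) (rarr s4 ''W'' 1 i) (correct_at s3 i n)"
    unfolding wp_def by blast
  note f4 = agreeD[OF exec_agree[OF e4]]
  define l u where "l = rarr s4 ''W'' 0" and "u = rarr s4 ''W'' 1"

  have "nreg s4 ''nV'' = nV" using f4 s3 by simp
  from wp_sort_row[OF this pos(4), of 0]
  obtain t5 s5 where e5: "exec (sort_row 0) s4 t5 s5" and t5: "real t5 \<le> 3000 * real nV * (log 2 (real nV) + 1)"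
    and W5: "vals (rarr s5 ''W'' 0) 0 nV = vals l 0 nV" "sorted_upto (rarr s5 ''W'' 0) nV"
      "rarr s5 ''W'' 1 = u"
    unfolding wp_def sorted_upto_def l_def u_def by auto
  note f5 = agreeD[OF exec_agree[OF e5]]

  have "nreg s5 ''nV'' = nV" using f5 f4 s3 by simp
  from wp_sort_row[OF this pos(4), of 1]
  obtain t6 s6 where e6: "exec (sort_row 1) s5 t6 s6" and t6: "real t6 \<le> 3000 * real nV * (log 2 (real nV) + 1)"
    and W6: "vals (rarr s6 ''W'' 1) 0 nV = vals u 0 nV" "sorted_upto (rarr s6 ''W'' 1) nV"
      "rarr s6 ''W'' 0 = rarr s5 ''W'' 0"
    unfolding wp_def sorted_upto_def W5(3)[symmetric] by auto
  note f6 = agreeD[OF exec_agree[OF e6]]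

  have nV6: "nreg s6 ''nV'' = nV" using f6 f5 f4 s3 by simp
  have "wp sweep s6 (\<lambda>t s'. t \<le> 200 * nV \<and>
    (let x = rreg s' ''x'' in \<exists>c. (\<forall>y. below (rarr s6 ''W'' 0) nV y \<le> c + below (rarr s6 ''W'' 1) nV y) \<and>
      (c = 0 \<and> x = 0 \<or> 0 < x \<and> x < 1 \<and>
        c + below (rarr s6 ''W'' 1) nV x \<le> strictly_below (rarr s6 ''W'' 0) nV x)))"
  proof (rule wp_sweep[OF nV6 pos(4) refl _ _ refl W6(2)])
    show "sorted_upto (rarr s6 ''W'' 0) nV" using W5 W6 by simp
    show "0 \<le> rarr s6 ''W'' 0 i" if "i < nV" for i
      by (rule vals_mem[OF W5(1) that]) (use W4 W6(3) in \<open>auto simp: l_def bounds_def\<close>)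
    show "rarr s6 ''W'' 1 i \<le> 1" if "i < nV" for i
      by (rule vals_mem[OF W6(1) that]) (use W4 in \<open>auto simp: u_def bounds_def\<close>)
  qed
  then obtain t7 s7 c where e7: "exec sweep s6 t7 s7" and t7: "t7 \<le> 200 * nV"
    and c: "\<And>y. below l nV y \<le> c + below u nV y"
    and x: "c = 0 \<and> rreg s7 ''x'' = 0 \<or> 0 < rreg s7 ''x'' \<and> rreg s7 ''x'' < 1 \<and>
      c + below u nV (rreg s7 ''x'') \<le> strictly_below l nV (rreg s7 ''x'')"
    unfolding wp_def Let_def W6(3) below_cong[OF W5(1)] below_cong[OF W6(1)] strictly_below_cong[OF W5(1)]
    by blast
  note f7 = agreeD[OF exec_agree[OF e7]]
  define x where "x = rreg s7 ''x''"
  have x01: "0 \<le> x" "x < 1" using x by (auto simp: x_def)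
  define \<gamma> where "\<gamma> = x / (1 - x)"
  have \<gamma>: "0 \<le> \<gamma>" using x01 by (simp add: \<gamma>_def)

  define s8 where "s8 = s7\<lparr>rreg := (rreg s7)(''g'' := \<gamma>)\<rparr>"
  have e8: "exec (RAssign ''g'' (RDiv (RReg ''x'') (RSub (RConst 1) (RReg ''x'')))) s7 6 s8"
    using exec.RAssign[of "''g''" "RDiv (RReg ''x'') (RSub (RConst 1) (RReg ''x''))" s7]
    by (simp add: s8_def \<gamma>_def x_def eval_nat_numeral)
  let ?e = "RMul (RReg ''g'') (RArr ''N'' (NReg ''i'') (NReg ''k''))"
  have s8: "nreg s8 ''n'' = n" "nreg s8 ''d'' = d" "rarr s8 ''N'' = rarr s3 ''N''" "rreg s8 ''g'' = \<gamma>"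
    using f7 f6 f5 f4 s3 by (simp_all add: s8_def)
  have "wp (fill ''Delta'' ?e) s8 (\<lambda>t s'. t \<le> 6000 * (n * d) \<and>
      (\<forall>a<n. \<forall>b<d. rarr s' ''Delta'' a b = nud \<gamma> $$ (a, b)))"
  proof (rule wp_fill)
    fix r :: store and a b
    assume *: "a < n" "b < d" "nreg r ''i'' = a" "nreg r ''k'' = b" "agree {''i'', ''k'', ''Delta''} s8 r"
    then show "rval ?e r = nud \<gamma> $$ (a, b)"
      using agreeD[OF *(5)] s8 by (simp add: N nud_index)
  qed (use s8 pos in auto)
  then obtain t9 s9 where e9: "exec (fill ''Delta'' ?e) s8 t9 s9" and t9: "t9 \<le> 6000 * (n * d)"
    and out: "\<forall>a<n. \<forall>b<d. rarr s9 ''Delta'' a b = nud \<gamma> $$ (a, b)"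
    unfolding wp_def by blast

  \<comment> \<open>The 14 units are the eight sequential compositions and the assignment of cost
    6.\<close>
  obtain t where run: "exec nudge_program s t s9"
    and t: "t = 14 + t1 + t2 + t3 + t4 + t5 + t6 + t7 + t9"
    using exec.Seq[OF e1 exec.Seq[OF e2 exec.Seq[OF e3 exec.Seq[OF e4 exec.Seq[OF e5
        exec.Seq[OF e6 exec.Seq[OF e7 exec.Seq[OF e8 e9]]]]]]]]
    unfolding nudge_program_def by (simp add: add_ac)
  have time: "real t \<le> 400000 * (real nV * (real n * real d + log 2 (real nV)) + real nT * real d)"
  proof -
    \<comment> \<open>All terms of order \<open>n * d\<close>, \<open>nV\<close> or 1 are at most
      multiples of \<open>P\<close>, since the dimensions are positive; this includes the part of
      the sorting time that is linear in \<open>nV\<close>. Their coefficients sum to less than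
      340000.\<close>
    define P where "P = real nV * (real n * real d)"
    define L where "L = real nV * log 2 (real nV)"
    have L: "0 \<le> L" using pos by (simp add: L_def)
    have "n * d \<le> nV * (n * d)" "nV \<le> nV * (n * d)" "1 \<le> nV * (n * d)" using pos by simp_all
    then have "real (n * d) \<le> real (nV * (n * d))" "real nV \<le> real (nV * (n * d))" "real 1 \<le> real (nV * (n * d))"
      by (simp_all only: of_nat_le_iff)
    then have P: "real n * real d \<le> P" "real nV \<le> P" "1 \<le> P" by (simp_all add: P_def)
    have "real t1 \<le> 6000 * (real n * real d)" "real t2 \<le> 6000 * (real nT * real d)"
      "real t3 \<le> 20000 * (real n * real d)" "real t4 \<le> 300000 * P" "real t7 \<le> 200 * real nV"
      "real t9 \<le> 6000 * (real n * real d)"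
      using t1[THEN of_nat_mono, where 'a = real] t2[THEN of_nat_mono, where 'a = real]
        t3[THEN of_nat_mono, where 'a = real] t4[THEN of_nat_mono, where 'a = real]
        t7[THEN of_nat_mono, where 'a = real] t9[THEN of_nat_mono, where 'a = real]
      by (simp_all add: P_def mult.assoc)
    moreover have "real t5 \<le> 3000 * L + 3000 * real nV" "real t6 \<le> 3000 * L + 3000 * real nV"
      using t5 t6 by (simp_all add: L_def algebra_simps)
    moreover have "0 \<le> real nT * real d" by simp
    ultimately have "real t \<le> 400000 * (P + L + real nT * real d)"
      using P L unfolding t of_nat_add by (simp; linarith)
    then show ?thesis by (simp add: P_def L_def algebra_simps)
  qed

  have score: "val_score D QV YV (nud (y / (1 - y))) = card {i. i < nV \<and> correct_at s3 i n y}" if "y < 1" for y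
  proof -
    have "val_correct D QV YV (nud (y / (1 - y))) i \<longleftrightarrow> correct_at s3 i n y" if "i < nV" for i
      by (rule val_correct_nud[OF QV that]) (use YV that s s3 N \<open>y < 1\<close> in \<open>auto simp: stores_mat_def\<close>)
    then have "val_score D QV YV (nud (y / (1 - y))) = (\<Sum>i<nV. of_bool (correct_at s3 i n y))"
      using QV by (simp add: val_score_def)
    also have "\<dots> = card {i. i < nV \<and> correct_at s3 i n y}"
      by (simp add: of_bool_def sum.If_cases Int_def)
    finally show ?thesis .
  qed
  have opt: "val_score D QV YV (nud \<gamma>') \<le> val_score D QV YV (nud \<gamma>)" if "0 \<le> \<gamma>'" for \<gamma>'
  proof -
    \<comment> \<open>This inverts \<open>y / (1 - y)\<close>, so every admissible magnitude is
      compared with \<open>\<gamma>\<close> inside the half-open unit interval where the sweep took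
      place.\<close>
    define y where "y = \<gamma>' / (1 + \<gamma>')"
    have y: "0 \<le> y" "y < 1" "\<gamma>' = y / (1 - y)"
      using that by (simp_all add: y_def field_simps)
    have "card {i. i < nV \<and> correct_at s3 i n y} \<le> card {i. i < nV \<and> correct_at s3 i n x}"
      by (rule sweep_optimal[where l = l and u = u and c = c])
        (use W4 c x y in \<open>auto simp: l_def u_def x_def\<close>)
    then show ?thesis
      using score[OF y(2)] score[OF x01(2)] y(3) by (simp add: \<gamma>_def)
  qed
  have "stores_mat s9 ''Delta'' (nud \<gamma>)" using out by (simp add: stores_mat_def)
  with run time arg_max_nud[where QV = QV and YV = YV, OF \<gamma> opt]
  show "\<exists>t s' \<gamma>. exec nudge_program s t s' \<and>
      real t \<le> 400000 * (real nV * (real n * real d + log 2 (real nV)) + real nT * real d) \<and>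
      stores_mat s' ''Delta'' (nud \<gamma>) \<and>
      ((\<forall>i<n. row G i \<noteq> 0\<^sub>v d) \<longrightarrow> BiMax_M_optimal D QT YT QV YV (\<gamma>, nud \<gamma>)) \<and>
      is_arg_max (BiMax_M_objective D QV YV)
        (\<lambda>x. BiMax_M_feasible D QT YT x \<and> fixes_untrained D QT YT x) (\<gamma>, nud \<gamma>)"
    by blast
qed

end
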